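(* If the system of total differential equations (T) has an $(s_1,s_2)$-nonautonomous $(n-k_1,n-k_2)$-cylindricality $\mathbb R$-differentiable last multiplier $\mu\colon(z,w)\mapsto\mu({}^sz,{}^kw)$ on $G'$ (of the form described in the context), then for every variable $\chi$ in the list $\mathcal V$ and all $(z,w)\in G$, $$W_\chi\bigl(1,{}^\lambda X^\theta(z,w),\operatorname{div}\mathfrak X_\theta(z,w)\bigr)=0,\quad \theta=1,\dots,s_1,$$ $$W_\chi\bigl({}^\lambda X^\eta(z,w),\operatorname{div}\mathfrak X_\eta(z,w)\bigr)=0,\quad \eta=s_1+1,\dots,m,$$ $$W_\chi\bigl(1,{}^\lambda X^{m+j_g}(z,w),\operatorname{div}\mathfrak X_{m+j_g}(z,w)\bigr)=0,\quad g=1,\dots,s_2,$$ $$W_\chi\bigl({}^\lambda X^{m+j_\nu}(z,w),\operatorname{div}\mathfrak X_{m+j_\nu}(z,w)\bigr)=0,\quad \nu=s_2+1,\dots,m.$$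
   Context: Setting. $G\subset\mathbb C^{m+n}$ is a domain with points $(z,w)$, $z=(z_1,\dots,z_m)$, $w=(w_1,\dots,w_n)$, and $G'\subset G$ is a subdomain. $\mathbb R$-differentiable means differentiable as a function of the real and imaginary parts of the variables (all higher derivatives that appear are assumed to exist); $\partial_{z_j},\partial_{\overline z_j},\partial_{w_\xi},\partial_{\overline w_\xi}$ are Wirtinger derivatives; bars over functions denote complex conjugation. System (T) is $$dw_\xi=\sum_{j=1}^m\bigl(X_{\xi j}(z,w)\,dz_j+X_{\xi,m+j}(z,w)\,d\overline z_j\bigr),\quad \xi=1,\dots,n,\tag{T}$$ with $\mathbb R$-differentiable $X_{\xi l}\colon G\to\mathbb C$. Put, for $j=1,\dots,m$, $\mathfrak X_j=\partial_{z_j}+\sum_{\xi=1}^n(X_{\xi j}\partial_{w_\xi}+\overline X_{\xi,m+j}\partial_{\overline w_\xi})$ and $\mathfrak X_{m+j}=\partial_{\overline z_j}+\sum_{\xi=1}^n(X_{\xi,m+j}\partial_{w_\xi}+\overline X_{\xi j}\partial_{\overline w_\xi})$; their divergences are $\operatorname{div}\mathfrak X_j=\sum_\xi(\partial_{w_\xi}X_{\xi j}+\partial_{\overline w_\xi}\overline X_{\xi,m+j})$ and $\operatorname{div}\mathfrak X_{m+j}=\sum_\xi(\partial_{w_\xi}X_{\xi,m+j}+\partial_{\overline w_\xi}\overline X_{\xi j})$. An $\mathbb R$-differentiable function $\mu\colon G'\to\mathbb C$ (not identically zero) is a last multiplier of (T) if $\mathfrak X_l\mu=-\mu\operatorname{div}\mathfrak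 X_l$ on $G'$, $l=1,\dots,2m$. Form of the functions. Fix integers $0\le s_1,s_2\le m$, $0\le k_1,k_2\le n$, a permutation $(j_1,\dots,j_m)$ of $(1,\dots,m)$ and a permutation $(\zeta_1,\dots,\zeta_n)$ of $(1,\dots,n)$. An $(s_1,s_2)$-nonautonomous $(n-k_1,n-k_2)$-cylindricality function $\mu({}^sz,{}^kw)$ is an $\mathbb R$-differentiable function on $G'$ that is antiholomorphic in $z_{s_1+1},\dots,z_m,w_{k_1+1},\dots,w_n$ and holomorphic in $z_{j_{s_2+1}},\dots,z_{j_m},w_{\zeta_{k_2+1}},\dots,w_{\zeta_n}$, i.e. $\partial_\chi\mu=0$ for every $\chi$ in the list $$\mathcal V=\{z_\alpha\ (\alpha>s_1),\ \overline z_{j_\beta}\ (\beta>s_2),\ w_\gamma\ (\gamma>k_1),\ \overline w_{\zeta_\delta}\ (\delta>k_2)\}.$$ Notation. $\lambda=k_1+k_2$; for $j=1,\dots,m$, $${}^\lambda X^j=(X_{1j},\dots,X_{k_1j},\overline X_{\zeta_1,m+j},\dots,\overline X_{\zeta_{k_2},m+j}),\quad {}^\lambda X^{m+j}=(X_{1,m+j},\dots,X_{k_1,m+j},\overline X_{\zeta_1j},\dots,\overline X_{\zeta_{k_2}j}).$$ $W_\chi(u_1,\dots,u_p)=\det(\partial_\chi^{\,i-1}u_k)_{i,k=1}^p$ is the Wronskian with respect to $\chi$.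
   Formalization: The identities are claimed at all points of G only if all X are real-analytic, otherwise at points of G in the closure of the set where μ≠0 (the literal claim fails); R-differentiable is read as C^{λ+2} for X and C^2 for μ. *)

theory Defs
  imports "HOL-Analysis.Analysis" "Jordan_Normal_Form.Determinant"
begin

text \<open>
  A point \<open>(z, w)\<close> of the \<open>(m+n)\<close>-dimensional complex space has type
  \<open>(complex ^ 'm) \<times> (complex ^ 'n)\<close>.  The coordinates are indexed by \<open>'m\<close> and \<open>'n\<close>; a numbering
  \<open>z_1, ..., z_m\<close> is given where needed by a bijection from \<open>{1..m}\<close> onto the index type.
\<close>

type_synonym ('m, 'n) cfun = "(complex ^ 'm) \<times> (complex ^ 'n) \<Rightarrow> complex"

text \<open>
  Continuous differentiability of order \<open>r\<close> in the real sense on an open set, that is, as a function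
  of the real and imaginary parts of the variables.
\<close>

fun R_differentiable ::
  "nat \<Rightarrow> ('a::real_normed_vector \<Rightarrow> complex) \<Rightarrow> 'a set \<Rightarrow> bool" where
  "R_differentiable 0 f S \<longleftrightarrow> continuous_on S f"
| "R_differentiable (Suc r) f S \<longleftrightarrow> f differentiable_on S \<and>
     (\<forall>v. R_differentiable r (\<lambda>p. frechet_derivative f (at p) v) S)"

text \<open>
  Real analyticity: near each point \<open>f\<close> is the sum of a power series in the real coordinates
  \<open>(x - p) \<bullet> b\<close>, which for complex vectors are the real and imaginary parts.  The multi-indices
  are the functions \<open>\<alpha> \<in> Basis \<rightarrow>\<^sub>E UNIV\<close>.
\<close>

definition real_analytic_on :: "('a::euclidean_space \<Rightarrow> complex) \<Rightarrow> 'a set \<Rightarrow> bool" where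
  "real_analytic_on f S \<longleftrightarrow> (\<forall>p\<in>S. \<exists>c :: ('a \<Rightarrow> nat) \<Rightarrow> complex. \<exists>r>0. \<forall>x\<in>ball p r.
     ((\<lambda>\<alpha>. c \<alpha> * of_real (\<Prod>b\<in>Basis. ((x - p) \<bullet> b) ^ \<alpha> b)) has_sum f x)
       (Basis \<rightarrow>\<^sub>E UNIV))"

datatype ('m, 'n) cvar = Z 'm | Zbar 'm | W 'n | Wbar 'n

fun wirtinger :: "('m::finite, 'n::finite) cvar \<Rightarrow> ('m, 'n) cfun \<Rightarrow> ('m, 'n) cfun" where
  "wirtinger (Z j) f p =
     (frechet_derivative f (at p) (axis j 1, 0)
       - \<i> * frechet_derivative f (at p) (axis j \<i>, 0)) / 2"
| "wirtinger (Zbar j) f p =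
     (frechet_derivative f (at p) (axis j 1, 0)
       + \<i> * frechet_derivative f (at p) (axis j \<i>, 0)) / 2"
| "wirtinger (W k) f p =
     (frechet_derivative f (at p) (0, axis k 1)
       - \<i> * frechet_derivative f (at p) (0, axis k \<i>)) / 2"
| "wirtinger (Wbar k) f p =
     (frechet_derivative f (at p) (0, axis k 1)
       + \<i> * frechet_derivative f (at p) (0, axis k \<i>)) / 2"

text \<open>
  The columns \<open>l = 1, ..., 2m\<close> of the coefficient matrix \<open>X \<xi> l\<close> of the system are indexed by
  \<open>'m + 'm\<close>: \<open>Inl j\<close> is column \<open>j\<close> (the coefficient of \<open>dz_j\<close>) and \<open>Inr j\<close> is column \<open>m + j\<close>
  (the coefficient of the conjugate differential).
\<close>

type_synonym ('m, 'n) coeffs = "'n \<Rightarrow> 'm + 'm \<Rightarrow> ('m, 'n) cfun"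

fun base_var :: "'m + 'm \<Rightarrow> ('m, 'n) cvar" where
  "base_var (Inl j) = Z j"
| "base_var (Inr j) = Zbar j"

fun conj_col :: "'m + 'm \<Rightarrow> 'm + 'm" where
  "conj_col (Inl j) = Inr j"
| "conj_col (Inr j) = Inl j"

definition vfield ::
  "('m::finite, 'n::finite) coeffs \<Rightarrow> 'm + 'm \<Rightarrow> ('m, 'n) cfun \<Rightarrow> ('m, 'n) cfun" where
  "vfield X l f p = wirtinger (base_var l) f p +
     (\<Sum>\<xi>\<in>UNIV. X \<xi> l p * wirtinger (W \<xi>) f p
               + cnj (X \<xi> (conj_col l) p) * wirtinger (Wbar \<xi>) f p)"

definition divergence ::
  "('m::finite, 'n::finite) coeffs \<Rightarrow> 'm + 'm \<Rightarrow> ('m, 'n) cfun" where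
  "divergence X l p =
     (\<Sum>\<xi>\<in>UNIV. wirtinger (W \<xi>) (X \<xi> l) p
               + wirtinger (Wbar \<xi>) (\<lambda>q. cnj (X \<xi> (conj_col l) q)) p)"

definition last_multiplier ::
  "('m::finite, 'n::finite) coeffs \<Rightarrow> ((complex ^ 'm) \<times> (complex ^ 'n)) set
     \<Rightarrow> ('m, 'n) cfun \<Rightarrow> bool" where
  "last_multiplier X S \<mu> \<longleftrightarrow> R_differentiable 1 \<mu> S \<and> (\<exists>p\<in>S. \<mu> p \<noteq> 0) \<and>
     (\<forall>l. \<forall>p\<in>S. vfield X l \<mu> p = - \<mu> p * divergence X l p)"

text \<open>
  The list of variables with respect to which an \<open>(s1,s2)\<close>-nonautonomous
  \<open>(n-k1,n-k2)\<close>-cylindricality function has vanishing derivative; \<open>a\<close> and \<open>b\<close> number the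
  coordinates of \<open>z\<close> and \<open>w\<close>.
\<close>

definition killed_vars ::
  "(nat \<Rightarrow> 'm::finite) \<Rightarrow> (nat \<Rightarrow> 'n::finite) \<Rightarrow> nat \<Rightarrow> nat \<Rightarrow> nat \<Rightarrow> nat
     \<Rightarrow> (nat \<Rightarrow> nat) \<Rightarrow> (nat \<Rightarrow> nat) \<Rightarrow> ('m, 'n) cvar set" where
  "killed_vars a b s1 s2 k1 k2 j \<zeta> =
     {Z (a \<alpha>) | \<alpha>. s1 < \<alpha> \<and> \<alpha> \<le> CARD('m)} \<union>
     {Zbar (a (j \<beta>)) | \<beta>. s2 < \<beta> \<and> \<beta> \<le> CARD('m)} \<union>
     {W (b \<gamma>) | \<gamma>. k1 < \<gamma> \<and> \<gamma> \<le> CARD('n)} \<union>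
     {Wbar (b (\<zeta> \<delta>)) | \<delta>. k2 < \<delta> \<and> \<delta> \<le> CARD('n)}"

definition cylindrical ::
  "('m::finite, 'n::finite) cvar set \<Rightarrow> ((complex ^ 'm) \<times> (complex ^ 'n)) set
     \<Rightarrow> ('m, 'n) cfun \<Rightarrow> bool" where
  "cylindrical V S \<mu> \<longleftrightarrow> (\<forall>v\<in>V. \<forall>p\<in>S. wirtinger v \<mu> p = 0)"

definition lamX ::
  "('m::finite, 'n::finite) coeffs \<Rightarrow> (nat \<Rightarrow> 'n) \<Rightarrow> nat \<Rightarrow> nat \<Rightarrow> (nat \<Rightarrow> nat)
     \<Rightarrow> 'm + 'm \<Rightarrow> ('m, 'n) cfun list" where
  "lamX X b k1 k2 \<zeta> l =
     map (\<lambda>\<xi>. X (b \<xi>) l) [1..<Suc k1] @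
     map (\<lambda>\<delta> q. cnj (X (b (\<zeta> \<delta>)) (conj_col l) q)) [1..<Suc k2]"

definition wronskian ::
  "('m::finite, 'n::finite) cvar \<Rightarrow> ('m, 'n) cfun list \<Rightarrow> ('m, 'n) cfun" where
  "wronskian v us p = Determinant.det (Matrix.mat (length us) (length us)
     (\<lambda>(i, k). (wirtinger v ^^ i) (us ! k) p))"

end

theory Submission
  imports Defs "HOL-Complex_Analysis.Conformal_Mappings"
begin

text \<open>
  Write \<open>D\<close> for the Wirtinger derivative in a variable \<open>v\<close> of \<open>killed_vars\<close>, so that \<open>D \<mu> = 0\<close>.  For the
  column \<open>l\<close> of the system, the multiplier equation is a linear relation between the functions
  \<open>u_k\<close> of the Wronskian: \<open>div X_l\<close> has the coefficient \<open>\<mu>\<close>, the entries of \<open>lamX\<close> have as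
  coefficients the derivatives of \<open>\<mu>\<close> in the variables \<open>w\<close> and their conjugates that are not
  killed, and the constant \<open>1\<close> has the derivative of \<open>\<mu>\<close> in the base variable of the column
  (\<open>reduced_multiplier_equation\<close>).  When this base variable is killed, the last term disappears,
  and with it the entry \<open>1\<close>.

  Wirtinger derivatives commute on twice continuously differentiable functions
  (\<open>wirtinger_commute\<close>), so \<open>D \<mu> = 0\<close> makes \<open>D\<close> annihilate every coefficient \<open>c_k\<close>.  Applying \<open>D\<close>
  repeatedly to \<open>\<Sum>k. c_k u_k = 0\<close> therefore gives \<open>\<Sum>k. c_k D^i u_k = 0\<close>
  (\<open>iterated_wirtinger_relation\<close>): the vector of coefficients is in the kernel of the Wronskian
  matrix.  One of its entries is \<open>\<mu>\<close>, so the Wronskian vanishes on the open set \<open>U\<close> where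
  \<open>\<mu>\<close> is nonzero, which is contained in \<open>G'\<close>.

  There are two ways to get from \<open>U\<close> to a point of \<open>G\<close>.  The Wronskian is continuous on \<open>G\<close>, so it
  vanishes on the closure of \<open>U\<close> in \<open>G\<close>.  If the coefficients of the system are real analytic, so is
  the Wronskian, and the identity theorem on the connected set \<open>G\<close> applies
  (\<open>real_analytic_on_identity\<close>).

  The theory of real analytic functions of several variables that this takes is developed without
  ever expanding a power series about a second centre.  Products are Cauchy products; a partial
  derivative is computed termwise, by grouping the series according to the exponent of one coordinate
  (\<open>has_sum_termwise_derivative\<close>).  For the identity theorem, a function vanishing on an open subset
  \<open>U\<close> of its ball of convergence is restricted to the rays from the centre through \<open>U\<close>: there it is a
  power series in one variable, whose coefficients are the values of the homogeneous parts of the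
  series.  These are polynomials that vanish on an open set, hence everywhere.
\<close>

section \<open>Families graded by an exponent\<close>

lemma has_sum_fibres:
  fixes f :: "'i \<Rightarrow> 'b::banach"
  assumes "(f has_sum s) A" "g ` A \<subseteq> J"
  shows "((\<lambda>n. infsum f {i \<in> A. g i = n}) has_sum s) J"
proof -
  have "bij_betw (\<lambda>i. (g i, i)) A (Sigma J (\<lambda>n. {i \<in> A. g i = n}))"
    using assms(2) by (intro bij_betwI[where g = snd]) auto
  from has_sum_reindex_bij_betw[OF this, of "f \<circ> snd" s] assms(1)
  have "((f \<circ> snd) has_sum s) (Sigma J (\<lambda>n. {i \<in> A. g i = n}))"
    by simp
  then show ?thesis
  proof (rule has_sum_SigmaD)
    fix n assume "n \<in> J"
    have "(f has_sum infsum f {i \<in> A. g i = n}) {i \<in> A. g i = n}"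
      by (intro has_sum_infsum summable_on_subset_banach[OF has_sum_imp_summable[OF assms(1)]]) auto
    then show "((\<lambda>i. (f \<circ> snd) (n, i)) has_sum infsum f {i \<in> A. g i = n}) {i \<in> A. g i = n}"
      by simp
  qed
qed

text \<open>
  Grading a summable family by the exponents \<open>d i\<close> turns it into a power series in one variable.  This
  will be used with two gradings of the multi-indices: the exponent of a single coordinate, and
  the total degree.
\<close>

lemma has_sum_power_grading:
  fixes c :: "'i \<Rightarrow> complex" and d :: "'i \<Rightarrow> nat"
  assumes "((\<lambda>i. c i * s ^ d i) has_sum S) A"
  shows "(\<lambda>n. infsum c {i \<in> A. d i = n} * s ^ n) sums S"
proof -
  have "infsum (\<lambda>i. c i * s ^ d i) {i \<in> A. d i = n} = infsum c {i \<in> A. d i = n} * s ^ n" for n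
    by (subst infsum_cong[where g = "\<lambda>i. c i * s ^ n"]) (simp_all add: infsum_cmult_left')
  with has_sum_fibres[OF assms, of d UNIV] show ?thesis
    by (intro has_sum_imp_sums) simp
qed

lemma summable_norm_power_fibre:
  fixes c :: "'i \<Rightarrow> complex" and d :: "'i \<Rightarrow> nat"
  assumes "(\<lambda>i. c i * of_real t ^ d i) summable_on A" "t > 0"
  shows "(\<lambda>i. norm (c i)) summable_on {i \<in> A. d i = n}"
proof -
  have "(\<lambda>i. norm (c i * of_real t ^ d i)) summable_on A"
    using assms(1) by (rule summable_on_iff_abs_summable_on_complex[THEN iffD1])
  then have "(\<lambda>i. norm (c i * of_real t ^ d i)) summable_on {i \<in> A. d i = n}"
    by (rule summable_on_subset_banach) auto
  then have "(\<lambda>i. norm (c i) * t ^ n) summable_on {i \<in> A. d i = n}"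
    by (rule summable_on_cong[THEN iffD1, rotated]) (use assms(2) in \<open>auto simp: norm_mult norm_power\<close>)
  then show ?thesis
    using assms(2) by (subst (asm) summable_on_cmult_left') auto
qed

lemma summable_power_grading_norm:
  fixes c :: "'i \<Rightarrow> complex" and d :: "'i \<Rightarrow> nat"
  assumes "(\<lambda>i. c i * of_real t ^ d i) summable_on A"
  shows "summable (\<lambda>n. infsum (\<lambda>i. norm (c i)) {i \<in> A. d i = n} * \<bar>t\<bar> ^ n)"
proof -
  have "(\<lambda>i. norm (c i * of_real t ^ d i)) summable_on A"
    using assms by (rule summable_on_iff_abs_summable_on_complex[THEN iffD1])
  then obtain S where "((\<lambda>i. norm (c i * of_real t ^ d i)) has_sum S) A"
    by (auto simp: summable_on_def)
  from has_sum_fibres[OF this, of d UNIV]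
  have "((\<lambda>n. infsum (\<lambda>i. norm (c i * of_real t ^ d i)) {i \<in> A. d i = n}) has_sum S) UNIV"
    by simp
  moreover have "infsum (\<lambda>i. norm (c i * of_real t ^ d i)) {i \<in> A. d i = n}
      = infsum (\<lambda>i. norm (c i)) {i \<in> A. d i = n} * \<bar>t\<bar> ^ n" for n
    by (subst infsum_cong[where g = "\<lambda>i. norm (c i) * \<bar>t\<bar> ^ n"])
       (simp_all add: infsum_cmult_left' norm_mult norm_power)
  ultimately show ?thesis
    by (auto dest!: has_sum_imp_sums simp: sums_iff)
qed

text \<open>
  Summability is known only for real parameters, since these move a point of a real space along a line.
  It carries over to complex parameters because an unconditionally summable family of complex numbers is
  absolutely summable.
\<close>

lemma summable_complex_power_grading:
  fixes c :: "'i \<Rightarrow> complex" and d :: "'i \<Rightarrow> nat"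
  assumes "\<And>s::real. \<bar>s\<bar> < \<rho> \<Longrightarrow> (\<lambda>i. c i * of_real s ^ d i) summable_on A"
    and "norm z < \<rho>"
  shows "summable (\<lambda>n. infsum c {i \<in> A. d i = n} * z ^ n)"
proof -
  \<comment> \<open>A real parameter strictly between \<open>norm z\<close> and \<open>\<rho>\<close>, to compare with.\<close>
  define t where "t = (norm z + \<rho>) / 2"
  have t: "norm z < t" "\<bar>t\<bar> < \<rho>" "t \<noteq> 0" "0 < t"
    using assms(2) norm_ge_zero[of z] by (auto simp: t_def simp del: norm_ge_zero)
  have c: "(\<lambda>i. norm (c i)) summable_on {i \<in> A. d i = n}" for n
    using assms(1)[OF t(2)] t(4) by (rule summable_norm_power_fibre)
  have "summable (\<lambda>n. infsum (\<lambda>i. norm (c i)) {i \<in> A. d i = n} * t ^ n)"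
    using summable_power_grading_norm[OF assms(1)[OF t(2)]] t by simp
  then show ?thesis
  proof (rule summable_comparison_test')
    fix n
    have "norm (infsum c {i \<in> A. d i = n} * z ^ n)
        \<le> infsum (\<lambda>i. norm (c i)) {i \<in> A. d i = n} * norm z ^ n"
      by (simp add: norm_mult norm_power mult_right_mono norm_infsum_bound c)
    also have "\<dots> \<le> infsum (\<lambda>i. norm (c i)) {i \<in> A. d i = n} * t ^ n"
      using t by (intro mult_left_mono power_mono infsum_nonneg) auto
    finally show "norm (infsum c {i \<in> A. d i = n} * z ^ n)
        \<le> infsum (\<lambda>i. norm (c i)) {i \<in> A. d i = n} * t ^ n" .
  qed
qed

text \<open>
  Grouping the family by exponents gives a power series, which is differentiated by the classical
  theorem.  What remains is that the differentiated family is unconditionally summable before the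
  grouping: its absolute values, grouped in the same way, are the differentiated power series with the
  coefficients \<open>b n\<close>, and this converges on the same interval.
\<close>

lemma has_sum_termwise_derivative:
  fixes c :: "'i \<Rightarrow> complex" and d :: "'i \<Rightarrow> nat" and \<phi> :: "real \<Rightarrow> complex"
  assumes sum: "\<And>s. \<bar>s\<bar> < \<rho> \<Longrightarrow> ((\<lambda>i. c i * of_real s ^ d i) has_sum \<phi> s) A"
    and s: "\<bar>s\<bar> < \<rho>"
    and deriv: "(\<phi> has_vector_derivative D) (at s)"
  shows "((\<lambda>i. of_nat (d i) * c i * of_real s ^ (d i - 1)) has_sum D) A"
proof -
  define a where "a n = infsum c {i \<in> A. d i = n}" for n
  define b where "b n = infsum (\<lambda>i. norm (c i)) {i \<in> A. d i = n}" for n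
  have summ: "(\<lambda>i. c i * of_real s ^ d i) summable_on A" if "\<bar>s\<bar> < \<rho>" for s
    using sum[OF that] by (rule has_sum_imp_summable)
  have a_summ: "summable (\<lambda>n. a n * z ^ n)" if "norm z < \<rho>" for z
    unfolding a_def by (rule summable_complex_power_grading[OF summ that])
  have "((\<lambda>z. \<Sum>n. a n * z ^ n) has_field_derivative (\<Sum>n. diffs a n * of_real s ^ n)) (at (of_real s))"
    using s by (intro termdiffs_strong'[where K = \<rho>] a_summ) auto
  then have "((\<lambda>t. \<Sum>n. a n * of_real t ^ n) has_vector_derivative (\<Sum>n. diffs a n * of_real s ^ n)) (at s)"
    using has_vector_derivative_real_field by blast
  moreover have "\<phi> t = (\<Sum>n. a n * of_real t ^ n)" if "\<bar>t\<bar> < \<rho>" for t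
    using has_sum_power_grading[OF sum[OF that]] by (simp add: a_def sums_iff)
  then have "\<forall>t\<in>{-\<rho><..<\<rho>}. (\<Sum>n. a n * of_real t ^ n) = \<phi> t"
    by auto
  ultimately have "(\<phi> has_vector_derivative (\<Sum>n. diffs a n * of_real s ^ n)) (at s)"
    using s by (auto elim!: has_vector_derivative_transform_within_open[where S = "{-\<rho><..<\<rho>}"])
  with deriv have D: "D = (\<Sum>n. diffs a n * of_real s ^ n)"
    by (rule vector_derivative_unique_at)
  have b_summ: "summable (\<lambda>n. b n * x ^ n)" if "norm x < \<rho>" for x :: real
  proof -
    have "summable (\<lambda>n. b n * \<bar>x\<bar> ^ n)"
      unfolding b_def using that by (intro summable_power_grading_norm summ) auto
    then show ?thesis
      by (rule summable_rabs_cancel[OF summable_comparison_test'])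
         (auto simp: abs_mult power_abs b_def infsum_nonneg)
  qed
  define g where "g i = of_nat (d i) * c i * of_real s ^ (d i - 1)" for i
  have c: "(\<lambda>i. norm (c i)) summable_on {i \<in> A. d i = n}" for n
  proof -
    define t where "t = (\<bar>s\<bar> + \<rho>) / 2"
    have t: "\<bar>t\<bar> < \<rho>" "0 < t" using s by (auto simp: t_def field_simps)
    show ?thesis
      using summ[OF t(1)] t(2) by (rule summable_norm_power_fibre)
  qed
  have norm_g: "((\<lambda>i. norm (g i)) has_sum (of_nat n * b n * \<bar>s\<bar> ^ (n - 1))) {i \<in> A. d i = n}" for n
  proof -
    have "((\<lambda>i. (of_nat n * norm (c i)) * \<bar>s\<bar> ^ (n - 1)) has_sum (of_nat n * b n * \<bar>s\<bar> ^ (n - 1)))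
        {i \<in> A. d i = n}"
      unfolding b_def by (intro has_sum_cmult_left has_sum_cmult_right has_sum_infsum c)
    then show ?thesis
      by (rule has_sum_cong[THEN iffD1, rotated]) (auto simp: g_def norm_mult norm_power)
  qed
  have "summable (\<lambda>n. diffs b n * \<bar>s\<bar> ^ n)"
    using s by (intro termdiff_converges[where K = \<rho>] b_summ) auto
  then have "summable (\<lambda>n. of_nat (Suc n) * b (Suc n) * \<bar>s\<bar> ^ (Suc n - 1))"
    by (simp add: diffs_def)
  then have "summable (\<lambda>n. of_nat n * b n * \<bar>s\<bar> ^ (n - 1))"
    by (subst (asm) summable_Suc_iff)
  then have "(\<lambda>n. of_nat n * b n * \<bar>s\<bar> ^ (n - 1)) summable_on UNIV"
    by (intro summable_nonneg_imp_summable_on) (auto simp: b_def infsum_nonneg)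
  then have "(\<lambda>(n,i). norm (g i)) summable_on Sigma UNIV (\<lambda>n. {i \<in> A. d i = n})"
    by (intro summable_on_SigmaI[where g = "\<lambda>n. of_nat n * b n * \<bar>s\<bar> ^ (n - 1)"]) (use norm_g in auto)
  moreover have "bij_betw (\<lambda>i. (d i, i)) A (Sigma UNIV (\<lambda>n. {i \<in> A. d i = n}))"
    by (intro bij_betwI[where g = snd]) auto
  ultimately have "(\<lambda>i. norm (g i)) summable_on A"
    using summable_on_reindex_bij_betw[of "\<lambda>i. (d i, i)" A _ "\<lambda>(n,i). norm (g i)"] by auto
  then have g: "(g has_sum infsum g A) A"
    by (rule has_sum_infsum[OF abs_summable_summable])
  have gn: "infsum g {i \<in> A. d i = n} = of_nat n * a n * of_real s ^ (n - 1)" for n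
  proof -
    have "((\<lambda>i. (of_nat n * c i) * of_real s ^ (n - 1)) has_sum (of_nat n * a n * of_real s ^ (n - 1)))
        {i \<in> A. d i = n}"
      unfolding a_def
      by (intro has_sum_cmult_left has_sum_cmult_right has_sum_infsum[OF abs_summable_summable] c)
    then have "(g has_sum (of_nat n * a n * of_real s ^ (n - 1))) {i \<in> A. d i = n}"
      by (rule has_sum_cong[THEN iffD1, rotated]) (auto simp: g_def)
    then show ?thesis by (rule infsumI)
  qed
  have "(\<lambda>n. of_nat n * a n * of_real s ^ (n - 1)) sums infsum g A"
    using has_sum_fibres[OF g, of d UNIV] by (intro has_sum_imp_sums) (simp add: gn)
  then have "(\<lambda>n. of_nat (Suc n) * a (Suc n) * of_real s ^ (Suc n - 1)) sums infsum g A"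
    by (subst sums_Suc_iff) simp
  then have "infsum g A = D"
    by (simp add: D diffs_def sums_iff)
  with g show ?thesis by (simp add: g_def[abs_def])
qed

section \<open>Real analytic functions of several variables\<close>

definition monom_at :: "'a::euclidean_space \<Rightarrow> ('a \<Rightarrow> nat) \<Rightarrow> real" where
  "monom_at y \<alpha> = (\<Prod>b\<in>Basis. (y \<bullet> b) ^ \<alpha> b)"

abbreviation multiindices :: "('a::euclidean_space \<Rightarrow> nat) set" where
  "multiindices \<equiv> Basis \<rightarrow>\<^sub>E UNIV"

definition power_series_on :: "(('a::euclidean_space \<Rightarrow> nat) \<Rightarrow> complex) \<Rightarrow> ('a \<Rightarrow> complex) \<Rightarrow> 'a \<Rightarrow> real \<Rightarrow> bool" where
  "power_series_on c f p r \<longleftrightarrow>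
     (\<forall>x\<in>ball p r. ((\<lambda>\<alpha>. c \<alpha> * of_real (monom_at (x - p) \<alpha>)) has_sum f x) multiindices)"

lemma real_analytic_on_altdef:
  "real_analytic_on f S \<longleftrightarrow> (\<forall>p\<in>S. \<exists>c. \<exists>r>0. power_series_on c f p r)"
  unfolding real_analytic_on_def power_series_on_def monom_at_def ..

lemma power_series_on_mono: "power_series_on c f p r \<Longrightarrow> r' \<le> r \<Longrightarrow> power_series_on c f p r'"
  unfolding power_series_on_def by auto

text \<open>
  The expansions of \<open>f\<close> and \<open>g\<close> about a point may have different radii; the smaller one serves both, so
  an operation has to be studied for a common centre and radius only.
\<close>

lemma real_analytic_on_binary:
  assumes "real_analytic_on f S" "real_analytic_on g S"
    and "\<And>c d p r. power_series_on c f p r \<Longrightarrow> power_series_on d g p r \<Longrightarrow> r > 0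
           \<Longrightarrow> \<exists>e. power_series_on e h p r"
  shows "real_analytic_on h S"
  unfolding real_analytic_on_altdef
proof
  fix p assume "p \<in> S"
  with assms(1,2) obtain c r d s where "r > 0" "s > 0" "power_series_on c f p r" "power_series_on d g p s"
    unfolding real_analytic_on_altdef by meson
  then have "min r s > 0" "power_series_on c f p (min r s)" "power_series_on d g p (min r s)"
    by (auto intro: power_series_on_mono)
  with assms(3) show "\<exists>c. \<exists>r>0. power_series_on c h p r"
    by blast
qed

lemma real_analytic_on_add:
  fixes f g :: "'a::euclidean_space \<Rightarrow> complex"
  assumes "real_analytic_on f S" "real_analytic_on g S"
  shows "real_analytic_on (\<lambda>x. f x + g x) S"
  using assms
proof (rule real_analytic_on_binary)
  fix c d :: "('a \<Rightarrow> nat) \<Rightarrow> complex" and p r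
  assume "power_series_on c f p r" "power_series_on d g p r"
  then have "power_series_on (\<lambda>\<alpha>. c \<alpha> + d \<alpha>) (\<lambda>x. f x + g x) p r"
    unfolding power_series_on_def by (auto intro: has_sum_add simp: ring_distribs)
  then show "\<exists>e. power_series_on e (\<lambda>x. f x + g x) p r" by blast
qed

lemma real_analytic_on_cnj:
  fixes f :: "'a::euclidean_space \<Rightarrow> complex"
  assumes "real_analytic_on f S"
  shows "real_analytic_on (\<lambda>x. cnj (f x)) S"
  using assms assms
proof (rule real_analytic_on_binary)
  fix c :: "('a \<Rightarrow> nat) \<Rightarrow> complex" and p r
  assume c: "power_series_on c f p r"
  have "power_series_on (\<lambda>\<alpha>. cnj (c \<alpha>)) (\<lambda>x. cnj (f x)) p r"
    unfolding power_series_on_def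
  proof
    fix x assume "x \<in> ball p r"
    with c have "((\<lambda>\<alpha>. c \<alpha> * of_real (monom_at (x - p) \<alpha>)) has_sum f x) multiindices"
      by (auto simp: power_series_on_def)
    then have "((\<lambda>\<alpha>. cnj (c \<alpha> * of_real (monom_at (x - p) \<alpha>))) has_sum cnj (f x)) multiindices"
      by (subst has_sum_cnj_iff)
    then show "((\<lambda>\<alpha>. cnj (c \<alpha>) * of_real (monom_at (x - p) \<alpha>)) has_sum cnj (f x)) multiindices"
      by simp
  qed
  then show "\<exists>e. power_series_on e (\<lambda>x. cnj (f x)) p r" by blast
qed

lemma real_analytic_on_const: "real_analytic_on (\<lambda>_::'a::euclidean_space. z) S"
  unfolding real_analytic_on_altdef
proof
  fix p :: 'a
  let ?o = "\<lambda>b\<in>Basis::'a set. 0::nat"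
  have "((\<lambda>\<alpha>. (if \<alpha> = ?o then z else 0) * of_real (monom_at (x - p) \<alpha>)) has_sum z) multiindices" for x
    by (rule has_sum_finite_neutralI[where B = "{?o}"]) (auto simp: monom_at_def)
  then show "\<exists>c. \<exists>r>0. power_series_on c (\<lambda>_. z) p r"
    unfolding power_series_on_def by (intro exI[of _ "\<lambda>\<alpha>. if \<alpha> = ?o then z else 0"] exI[of _ 1]) auto
qed

lemma has_sum_times:
  fixes f :: "'i \<Rightarrow> complex" and g :: "'j \<Rightarrow> complex"
  assumes "(f has_sum s) A" "(g has_sum t) B"
  shows "((\<lambda>(i, j). f i * g j) has_sum s * t) (A \<times> B)"
proof -
  have "(\<lambda>i. norm (f i)) summable_on A" "(\<lambda>j. norm (g j)) summable_on B"
    using assms summable_on_iff_abs_summable_on_complex has_sum_imp_summable by blast+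
  then have "(\<lambda>(i, j). norm (f i) * norm (g j)) summable_on A \<times> B"
    by (intro summable_on_SigmaI[where g = "\<lambda>i. norm (f i) * infsum (\<lambda>j. norm (g j)) B"])
       (auto intro!: has_sum_cmult_right summable_on_cmult_left)
  then have "(\<lambda>x. norm ((\<lambda>(i, j). f i * g j) x)) summable_on A \<times> B"
    by (simp add: case_prod_unfold norm_mult)
  then have "(\<lambda>(i, j). f i * g j) summable_on A \<times> B"
    by (rule abs_summable_summable)
  then show ?thesis
    using assms by (intro has_sum_SigmaI[where g = "\<lambda>i. f i * t"])
      (auto intro!: has_sum_cmult_right has_sum_cmult_left)
qed

text \<open>
  The Cauchy product: the family of all products of terms is summable, and is grouped by the sum
  of the two multi-indices.  That sum has to be restricted to \<open>Basis\<close>, because multi-indices are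
  undefined elsewhere.
\<close>

lemma real_analytic_on_mult:
  fixes f g :: "'a::euclidean_space \<Rightarrow> complex"
  assumes "real_analytic_on f S" "real_analytic_on g S"
  shows "real_analytic_on (\<lambda>x. f x * g x) S"
  using assms
proof (rule real_analytic_on_binary)
  fix c d :: "('a \<Rightarrow> nat) \<Rightarrow> complex" and p r
  assume c: "power_series_on c f p r" and d: "power_series_on d g p r"
  define add :: "('a \<Rightarrow> nat) \<times> ('a \<Rightarrow> nat) \<Rightarrow> 'a \<Rightarrow> nat"
    where "add = (\<lambda>(\<alpha>, \<beta>). \<lambda>b\<in>Basis. \<alpha> b + \<beta> b)"
  define M where "M = (multiindices :: ('a \<Rightarrow> nat) set)"
  define e where "e \<gamma> = infsum (\<lambda>(\<alpha>, \<beta>). c \<alpha> * d \<beta>) {x \<in> M \<times> M. add x = \<gamma>}" for \<gamma>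
  have "((\<lambda>\<gamma>. e \<gamma> * of_real (monom_at (x - p) \<gamma>)) has_sum f x * g x) M" if "x \<in> ball p r" for x
  proof -
    define y where "y = x - p"
    have monom_add: "monom_at y (add (\<alpha>, \<beta>)) = monom_at y \<alpha> * monom_at y \<beta>" for \<alpha> \<beta>
      by (simp add: monom_at_def add_def power_add prod.distrib)
    have "((\<lambda>\<alpha>. c \<alpha> * of_real (monom_at y \<alpha>)) has_sum f x) M" "((\<lambda>\<alpha>. d \<alpha> * of_real (monom_at y \<alpha>)) has_sum g x) M"
      using c d that by (auto simp: power_series_on_def M_def y_def)
    then have "((\<lambda>(\<alpha>, \<beta>). (c \<alpha> * of_real (monom_at y \<alpha>)) * (d \<beta> * of_real (monom_at y \<beta>))) has_sum f x * g x) (M \<times> M)"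
      by (rule has_sum_times)
    then have "((\<lambda>z. (\<lambda>(\<alpha>, \<beta>). c \<alpha> * d \<beta>) z * of_real (monom_at y (add z))) has_sum f x * g x) (M \<times> M)"
      by (rule has_sum_cong[THEN iffD1, rotated]) (auto simp: monom_add)
    moreover have "add ` (M \<times> M) \<subseteq> M"
      by (auto simp: M_def add_def)
    ultimately have "((\<lambda>\<gamma>. infsum (\<lambda>z. (\<lambda>(\<alpha>, \<beta>). c \<alpha> * d \<beta>) z * of_real (monom_at y (add z))) {z \<in> M \<times> M. add z = \<gamma>})
        has_sum f x * g x) M"
      by (rule has_sum_fibres)
    moreover have "infsum (\<lambda>z. (\<lambda>(\<alpha>, \<beta>). c \<alpha> * d \<beta>) z * of_real (monom_at y (add z))) {z \<in> M \<times> M. add z = \<gamma>}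
        = e \<gamma> * of_real (monom_at y \<gamma>)" for \<gamma>
    proof -
      have "infsum (\<lambda>z. (\<lambda>(\<alpha>, \<beta>). c \<alpha> * d \<beta>) z * of_real (monom_at y (add z))) {z \<in> M \<times> M. add z = \<gamma>}
        = infsum (\<lambda>z. (\<lambda>(\<alpha>, \<beta>). c \<alpha> * d \<beta>) z * of_real (monom_at y \<gamma>)) {z \<in> M \<times> M. add z = \<gamma>}"
        by (rule infsum_cong) auto
      then show ?thesis
        by (simp only: e_def infsum_cmult_left')
    qed
    ultimately show ?thesis
      by (simp add: y_def)
  qed
  then have "power_series_on e (\<lambda>x. f x * g x) p r"
    by (auto simp: power_series_on_def M_def)
  then show "\<exists>e. power_series_on e (\<lambda>x. f x * g x) p r" by blast
qed

lemma real_analytic_on_sum: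
  assumes "\<And>i. i \<in> I \<Longrightarrow> real_analytic_on (f i) S"
  shows "real_analytic_on (\<lambda>x. \<Sum>i\<in>I. f i x) S"
  using assms by (induction I rule: infinite_finite_induct)
    (auto intro!: real_analytic_on_const real_analytic_on_add)

lemma real_analytic_on_prod:
  assumes "\<And>i. i \<in> I \<Longrightarrow> real_analytic_on (f i) S"
  shows "real_analytic_on (\<lambda>x. \<Prod>i\<in>I. f i x) S"
  using assms by (induction I rule: infinite_finite_induct)
    (auto intro!: real_analytic_on_const real_analytic_on_mult)

text \<open>
  Only the coordinate \<open>t\<close> along \<open>b\<close> varies.  The points of the line \<open>x' t\<close> that lie in the ball
  form the symmetric interval \<open>\<bar>t\<bar> < \<rho>\<close>, so that the restriction of the series to the line
  is a power series in \<open>t\<close> about \<open>0\<close> and can be differentiated termwise.  The differentiated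
  series is then reindexed by lowering the exponent of \<open>b\<close> by one.
\<close>

lemma power_series_on_partial_derivative:
  fixes f :: "'a::euclidean_space \<Rightarrow> complex"
  assumes c: "power_series_on c f p r" and b: "b \<in> Basis"
    and diff: "\<And>x. x \<in> ball p r \<Longrightarrow> f differentiable (at x)"
  shows "power_series_on (\<lambda>\<alpha>. of_nat (Suc (\<alpha> b)) * c (\<alpha>(b := Suc (\<alpha> b))))
           (\<lambda>x. frechet_derivative f (at x) b) p r"
  unfolding power_series_on_def
proof
  fix x assume x: "x \<in> ball p r"
  define y where "y = x - p"
  define s where "s = y \<bullet> b"
  define \<rho> where "\<rho> = sqrt (r\<^sup>2 - ((norm y)\<^sup>2 - s\<^sup>2))"
  define x' where "x' t = x + (t - s) *\<^sub>R b" for t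
  define P where "P \<alpha> = (\<Prod>b'\<in>Basis - {b}. (y \<bullet> b') ^ \<alpha> b')" for \<alpha> :: "'a \<Rightarrow> nat"
  have y_less: "norm y < r" using x by (simp add: y_def dist_norm norm_minus_commute)
  then have r: "r > 0" using norm_ge_zero[of y] by linarith
  have y2: "(norm y)\<^sup>2 < r\<^sup>2" using y_less by (intro power_strict_mono) auto
  have bb: "b \<bullet> b = 1" using b by (simp add: inner_Basis)
  have in_ball: "x' t \<in> ball p r" if "\<bar>t\<bar> < \<rho>" for t
  proof -
    have "t\<^sup>2 < \<rho>\<^sup>2" using that by (metis abs_ge_zero power2_abs power_strict_mono zero_less_numeral)
    also have "\<rho>\<^sup>2 = r\<^sup>2 - ((norm y)\<^sup>2 - s\<^sup>2)"
      unfolding \<rho>_def using y2 by (intro real_sqrt_pow2) (use y2 zero_le_power2[of s] in linarith)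
    finally have "(norm y)\<^sup>2 - s\<^sup>2 + t\<^sup>2 < r\<^sup>2" by simp
    moreover have "(norm (x' t - p))\<^sup>2 = (norm y)\<^sup>2 - s\<^sup>2 + t\<^sup>2"
    proof -
      have "x' t - p = y + (t - s) *\<^sub>R b" by (simp add: x'_def y_def)
      then show ?thesis
        by (simp add: power2_norm_eq_inner inner_add_left inner_add_right inner_commute[of b y] bb s_def[symmetric])
           (simp add: power2_eq_square algebra_simps)
    qed
    ultimately have "norm (x' t - p) < r"
      using r by (intro power2_less_imp_less[of _ r]) auto
    then show ?thesis by (simp add: dist_norm norm_minus_commute)
  qed
  have monom: "monom_at (x' t - p) \<alpha> = P \<alpha> * t ^ \<alpha> b" for t \<alpha>
  proof -
    have "(x' t - p) \<bullet> b' = y \<bullet> b'" if "b' \<in> Basis - {b}" for b'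
      using that b by (auto simp: x'_def y_def inner_add_left inner_diff_left inner_Basis)
    moreover have "(x' t - p) \<bullet> b = t"
      by (simp add: x'_def inner_add_left inner_diff_left bb s_def y_def)
    ultimately show ?thesis
      unfolding monom_at_def P_def using b by (subst prod.remove[of _ b]) auto
  qed
  have sums: "((\<lambda>\<alpha>. (c \<alpha> * of_real (P \<alpha>)) * of_real t ^ \<alpha> b) has_sum f (x' t)) multiindices" if "\<bar>t\<bar> < \<rho>" for t
    using bspec[OF c[unfolded power_series_on_def] in_ball[OF that]] by (simp add: monom mult.assoc)
  have s: "\<bar>s\<bar> < \<rho>"
    unfolding \<rho>_def using y2 by (intro real_less_rsqrt) simp
  have "(f has_derivative frechet_derivative f (at x)) (at (x' s))"
    using diff[OF x] by (simp add: x'_def frechet_derivative_works)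
  moreover have "(x' has_vector_derivative b) (at s)"
    unfolding x'_def by (auto intro!: derivative_eq_intros)
  ultimately have "((\<lambda>t. f (x' t)) has_vector_derivative frechet_derivative f (at x) b) (at s)"
    unfolding has_vector_derivative_def
    by (auto dest: diff_chain_at simp: o_def linear_cmul linear_frechet_derivative diff[OF x])
  from has_sum_termwise_derivative[OF sums s this]
  have *: "((\<lambda>\<alpha>. of_nat (\<alpha> b) * (c \<alpha> * of_real (P \<alpha>)) * of_real s ^ (\<alpha> b - 1))
      has_sum frechet_derivative f (at x) b) multiindices" .
  then have "((\<lambda>\<alpha>. of_nat (\<alpha> b) * (c \<alpha> * of_real (P \<alpha>)) * of_real s ^ (\<alpha> b - 1))
      has_sum frechet_derivative f (at x) b) {\<alpha> \<in> multiindices. \<alpha> b > 0}"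
    by (rule has_sum_cong_neutral[THEN iffD1, rotated 3]) auto
  moreover have "monom_at y \<alpha> = P \<alpha> * s ^ \<alpha> b" for \<alpha>
    using monom[of s] by (simp add: x'_def y_def)
  moreover have P_upd: "P (\<alpha>(b := n)) = P \<alpha>" for \<alpha> n
    unfolding P_def by (intro prod.cong) auto
  moreover have "bij_betw (\<lambda>\<alpha>. \<alpha>(b := Suc (\<alpha> b))) multiindices {\<alpha> \<in> multiindices. \<alpha> b > 0}"
    using b by (intro bij_betwI[where g = "\<lambda>\<alpha>. \<alpha>(b := \<alpha> b - 1)"]) (auto simp: PiE_def extensional_def)
  ultimately show "((\<lambda>\<alpha>. of_nat (Suc (\<alpha> b)) * c (\<alpha>(b := Suc (\<alpha> b))) * of_real (monom_at (x - p) \<alpha>))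
      has_sum frechet_derivative f (at x) b) multiindices"
    by (subst (asm) has_sum_reindex_bij_betw[symmetric]) (auto simp: y_def mult_ac)
qed

lemma real_analytic_on_partial_derivative:
  fixes f :: "'a::euclidean_space \<Rightarrow> complex"
  assumes f: "real_analytic_on f S" and S: "open S" and diff: "f differentiable_on S" and b: "b \<in> Basis"
  shows "real_analytic_on (\<lambda>x. frechet_derivative f (at x) b) S"
  unfolding real_analytic_on_altdef
proof
  fix p assume p: "p \<in> S"
  with f obtain c r where "r > 0" "power_series_on c f p r"
    unfolding real_analytic_on_altdef by blast
  moreover from p S obtain r' where "r' > 0" "ball p r' \<subseteq> S"
    using open_contains_ball by blast
  ultimately have *: "min r r' > 0" "power_series_on c f p (min r r')" "ball p (min r r') \<subseteq> S"
    by (auto intro: power_series_on_mono)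
  moreover have "f differentiable (at x)" if "x \<in> ball p (min r r')" for x
    using that *(3) diff S unfolding differentiable_on_def by (metis at_within_open subsetD)
  ultimately show "\<exists>c. \<exists>r>0. power_series_on c (\<lambda>x. frechet_derivative f (at x) b) p r"
    using power_series_on_partial_derivative[OF *(2) b] by blast
qed

section \<open>The identity theorem\<close>

definition homogeneous_part ::
  "(('a::euclidean_space \<Rightarrow> nat) \<Rightarrow> complex) \<Rightarrow> nat \<Rightarrow> 'a \<Rightarrow> complex" where
  "homogeneous_part c k h = infsum (\<lambda>\<alpha>. c \<alpha> * of_real (monom_at h \<alpha>)) {\<alpha> \<in> multiindices. sum \<alpha> Basis = k}"

lemma monom_at_scaleR: "monom_at (t *\<^sub>R h) \<alpha> = monom_at h \<alpha> * t ^ sum \<alpha> Basis"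
  by (simp add: monom_at_def power_mult_distrib prod.distrib power_sum mult.commute)

lemma has_sum_along_ray:
  assumes "power_series_on c f p r" "p + t *\<^sub>R h \<in> ball p r"
  shows "((\<lambda>\<alpha>. (c \<alpha> * of_real (monom_at h \<alpha>)) * of_real t ^ sum \<alpha> Basis) has_sum f (p + t *\<^sub>R h)) multiindices"
  using bspec[OF assms(1)[unfolded power_series_on_def] assms(2)]
  by (simp add: monom_at_scaleR mult.assoc)

text \<open>
  On the ray from \<open>p\<close> through \<open>u\<close> the function is the power series \<open>F\<close> with the coefficients
  \<open>homogeneous_part c k (u - p)\<close>, and the point \<open>u\<close> corresponds to the parameter \<open>1\<close>.  This series
  converges beyond \<open>1\<close> and vanishes at the real parameters close to \<open>1\<close>, hence identically.
\<close>

lemma homogeneous_part_zero_at: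
  fixes f :: "'a::euclidean_space \<Rightarrow> complex"
  assumes c: "power_series_on c f p r"
    and U: "open U" "U \<subseteq> ball p r" "u \<in> U" and zero: "\<And>x. x \<in> U \<Longrightarrow> f x = 0"
  shows "homogeneous_part c k (u - p) = 0"
proof -
  define h where "h = u - p"
  define a where "a k = homogeneous_part c k h" for k
  define F where "F z = (\<Sum>k. a k * z ^ k)" for z
  have h: "norm h < r"
    using U by (auto simp: h_def dist_norm norm_minus_commute)
  obtain R where R: "R > 1" "R * norm h < r"
  proof (cases "h = 0")
    case True
    with h that[of 2] show ?thesis by simp
  next
    case False
    with h that[of "(1 + r / norm h) / 2"] show ?thesis
      by (simp add: field_simps)
  qed
  have ray: "p + t *\<^sub>R h \<in> ball p r" if "\<bar>t\<bar> < R" for t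
  proof -
    have "\<bar>t\<bar> * norm h \<le> R * norm h" using that by (intro mult_right_mono) auto
    with R show ?thesis by (simp add: dist_norm)
  qed
  have a_eq: "a k = infsum (\<lambda>\<alpha>. c \<alpha> * of_real (monom_at h \<alpha>)) {\<alpha> \<in> multiindices. sum \<alpha> Basis = k}" for k
    by (simp add: a_def homogeneous_part_def)
  have F_sums: "(\<lambda>k. a k * z ^ k) sums F z" if "norm z < R" for z
  proof -
    have "summable (\<lambda>k. a k * z ^ k)"
      unfolding a_eq
    proof (rule summable_complex_power_grading[OF _ that])
      fix s :: real assume "\<bar>s\<bar> < R"
      from has_sum_along_ray[OF c ray[OF this]]
      show "(\<lambda>\<alpha>. c \<alpha> * of_real (monom_at h \<alpha>) * of_real s ^ sum \<alpha> Basis) summable_on multiindices"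
        by (rule has_sum_imp_summable)
    qed
    then show ?thesis by (simp add: F_def summable_sums)
  qed
  have F_real: "F (of_real t) = f (p + t *\<^sub>R h)" if "\<bar>t\<bar> < R" for t
  proof -
    have "(\<lambda>k. a k * of_real t ^ k) sums f (p + t *\<^sub>R h)"
      unfolding a_eq by (rule has_sum_power_grading[OF has_sum_along_ray[OF c ray[OF that]]])
    moreover have "(\<lambda>k. a k * of_real t ^ k) sums F (of_real t)"
      using that by (intro F_sums) simp
    ultimately show ?thesis
      using sums_unique2 by blast
  qed
  have "F holomorphic_on ball 0 R"
    by (rule power_series_holomorphic[where a = a]) (use F_sums in auto)
  moreover have "(1::complex) islimpt of_real ` {t. \<bar>t\<bar> < R \<and> p + t *\<^sub>R h \<in> U}"
  proof -
    have "open {t. p + t *\<^sub>R h \<in> U}"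
      using open_vimage[OF U(1), of "\<lambda>t. p + t *\<^sub>R h"]
      by (simp add: vimage_def continuous_intros)
    moreover have "open {t::real. \<bar>t\<bar> < R}"
      by (intro open_Collect_less continuous_intros)
    ultimately have "open ({t. \<bar>t\<bar> < R} \<inter> {t. p + t *\<^sub>R h \<in> U})" by blast
    moreover have "1 \<in> {t. \<bar>t\<bar> < R} \<inter> {t. p + t *\<^sub>R h \<in> U}"
      using R U by (simp add: h_def)
    ultimately obtain e where e: "e > 0" "ball 1 e \<subseteq> {t. \<bar>t\<bar> < R} \<inter> {t. p + t *\<^sub>R h \<in> U}"
      using open_contains_ball by blast
    show ?thesis
      unfolding islimpt_approachable
    proof (intro allI impI)
      fix \<epsilon> :: real assume "\<epsilon> > 0"
      then obtain \<delta> where \<delta>: "\<delta> > 0" "\<delta> < \<epsilon>" "\<delta> < e"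
        using e(1) field_lbound_gt_zero by blast
      define t where "t = 1 + \<delta>"
      have t: "t \<noteq> 1" "dist t 1 < \<epsilon>" "t \<in> ball 1 e"
        using \<delta> by (simp_all add: t_def dist_real_def)
      from t(3) e(2) have "t \<in> {t. \<bar>t\<bar> < R \<and> p + t *\<^sub>R h \<in> U}"
        by blast
      moreover have "dist (complex_of_real t) 1 < \<epsilon>"
        using dist_of_real[of t 1, where 'a = complex] t(2) by (simp only: of_real_1)
      ultimately show "\<exists>x'\<in>of_real ` {t. \<bar>t\<bar> < R \<and> p + t *\<^sub>R h \<in> U}. x' \<noteq> 1 \<and> dist x' (1::complex) < \<epsilon>"
        using t(1) by (intro bexI[of _ "of_real t"]) (simp_all only: imageI of_real_eq_1_iff simp_thms)
    qed
  qed
  moreover have "F z = 0" if "z \<in> of_real ` {t. \<bar>t\<bar> < R \<and> p + t *\<^sub>R h \<in> U}" for z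
    using that F_real zero by auto
  moreover have "of_real ` {t. \<bar>t\<bar> < R \<and> p + t *\<^sub>R h \<in> U} \<subseteq> ball (0::complex) R"
    by auto
  moreover have "(1::complex) \<in> ball 0 R"
    using R by simp
  ultimately have F0: "F z = 0" if "z \<in> ball 0 R" for z
    using analytic_continuation[OF _ open_ball connected_ball _ _ _ _ that] by blast
  have sums0: "(\<lambda>k. a k * z ^ k) sums 0" if "norm z < R" for z
    using F_sums[OF that] F0[of z] that by simp
  have "a k = 0"
  proof (cases "k = 0")
    case True
    from sums0[of 0] R have "(\<lambda>k. a k * 0 ^ k) sums 0" by simp
    with True show ?thesis by (simp only: powser_sums_zero_iff)
  next
    case False
    show ?thesis
    proof (rule ccontr)
      assume "a k \<noteq> 0"
      then obtain s where "0 < s" "\<And>z::complex. z \<in> cball 0 s - {0} \<Longrightarrow> (0::complex) \<noteq> 0"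
        using powser_0_nonzero[of R 0 a "\<lambda>_. 0" k] sums0 R False by auto
      from this(2)[of "of_real s"] this(1) show False by simp
    qed
  qed
  then show ?thesis by (simp add: a_def h_def)
qed

lemma homogeneous_part_eq_sum:
  "homogeneous_part c k h = (\<Sum>\<alpha> | \<alpha> \<in> multiindices \<and> sum \<alpha> Basis = k. c \<alpha> * of_real (monom_at h \<alpha>))"
proof -
  have "{\<alpha> \<in> multiindices. sum \<alpha> (Basis::'a set) = k} \<subseteq> Basis \<rightarrow>\<^sub>E {..k}"
    by (auto simp: PiE_def Pi_def intro: member_le_sum)
  then have "finite {\<alpha> \<in> multiindices. sum \<alpha> (Basis::'a set) = k}"
    by (rule finite_subset) (auto intro: finite_PiE)
  then show ?thesis
    by (simp add: homogeneous_part_def)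
qed

text \<open>
  On the line through \<open>v\<close> and \<open>x\<close> a homogeneous part is a polynomial in the parameter, and it has
  infinitely many zeros near \<open>v\<close>.
\<close>

lemma homogeneous_part_eq_0:
  fixes V :: "'a::euclidean_space set"
  assumes V: "open V" "v \<in> V" and zero: "\<And>h. h \<in> V \<Longrightarrow> homogeneous_part c k h = 0"
  shows "homogeneous_part c k x = 0"
proof -
  define q where "q = (\<Sum>\<alpha> | \<alpha> \<in> multiindices \<and> sum \<alpha> (Basis::'a set) = k.
     Polynomial.smult (c \<alpha>) (\<Prod>b\<in>Basis. [:complex_of_real (v \<bullet> b), complex_of_real ((x - v) \<bullet> b):] ^ \<alpha> b))"
  have q: "poly q (of_real t) = homogeneous_part c k (v + t *\<^sub>R (x - v))" for t
    by (simp add: q_def homogeneous_part_eq_sum monom_at_def poly_sum poly_prod inner_add_left)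
  have "open {t. v + t *\<^sub>R (x - v) \<in> V}"
    using open_vimage[OF V(1), of "\<lambda>t. v + t *\<^sub>R (x - v)"]
    by (simp add: vimage_def continuous_intros)
  moreover have "0 \<in> {t. v + t *\<^sub>R (x - v) \<in> V}" using V by simp
  ultimately have "infinite {t. v + t *\<^sub>R (x - v) \<in> V}"
    using not_open_singleton[of "0::real"] finite_imp_not_open by blast
  then have "infinite (complex_of_real ` {t. v + t *\<^sub>R (x - v) \<in> V})"
    by (subst finite_image_iff) (auto simp: inj_on_def)
  moreover have "complex_of_real ` {t. v + t *\<^sub>R (x - v) \<in> V} \<subseteq> {z. poly q z = 0}"
    by (auto simp: q zero)
  ultimately have "q = 0"
    using poly_roots_finite finite_subset by blast
  with q[of 1] show ?thesis by simp
qed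

lemma power_series_on_eq_0:
  fixes f :: "'a::euclidean_space \<Rightarrow> complex"
  assumes c: "power_series_on c f p r"
    and U: "open U" "U \<subseteq> ball p r" "U \<noteq> {}" "\<And>x. x \<in> U \<Longrightarrow> f x = 0"
    and x: "x \<in> ball p r"
  shows "f x = 0"
proof -
  from U(3) obtain u where u: "u \<in> U" by blast
  have "open ((\<lambda>x. x - p) ` U)"
    using open_translation_subtract[OF U(1)] .
  moreover have "u - p \<in> (\<lambda>x. x - p) ` U"
    using u by (rule imageI)
  moreover have "homogeneous_part c k h = 0" if "h \<in> (\<lambda>x. x - p) ` U" for k h
    using that homogeneous_part_zero_at[OF c U(1,2) _ U(4)] by blast
  ultimately have "homogeneous_part c k (x - p) = 0" for k
    by (rule homogeneous_part_eq_0)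
  moreover have "(\<lambda>k. homogeneous_part c k (x - p) * of_real 1 ^ k) sums f (p + 1 *\<^sub>R (x - p))"
    unfolding homogeneous_part_def
    by (rule has_sum_power_grading[OF has_sum_along_ray[OF c]]) (use x in simp)
  ultimately show ?thesis by (simp add: sums_iff)
qed

text \<open>
  The interior \<open>A\<close> of the zero set is closed in \<open>S\<close>: a ball of convergence about a point of
  \<open>S\<close> that meets \<open>A\<close> is contained in \<open>A\<close>.
\<close>

theorem real_analytic_on_identity:
  fixes f :: "'a::euclidean_space \<Rightarrow> complex"
  assumes f: "real_analytic_on f S" and S: "open S" "connected S"
    and U: "open U" "U \<subseteq> S" "U \<noteq> {}" "\<And>x. x \<in> U \<Longrightarrow> f x = 0"
    and x: "x \<in> S"
  shows "f x = 0"
proof -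
  define A where "A = interior {x \<in> S. f x = 0}"
  have A: "open A" "A \<subseteq> S" "\<And>x. x \<in> A \<Longrightarrow> f x = 0"
    using interior_subset[of "{x \<in> S. f x = 0}"] by (auto simp: A_def)
  have "U \<subseteq> A"
    unfolding A_def using U by (intro interior_maximal) auto
  have "open (S - A)"
    unfolding open_contains_ball
  proof
    fix p assume p: "p \<in> S - A"
    with f obtain c r where c: "r > 0" "power_series_on c f p r"
      unfolding real_analytic_on_altdef by blast
    from p S obtain r' where r': "r' > 0" "ball p r' \<subseteq> S"
      using open_contains_ball by blast
    define e where "e = min r r'"
    have e: "e > 0" "power_series_on c f p e" "ball p e \<subseteq> S"
      using c r' by (auto simp: e_def intro: power_series_on_mono)
    have "A \<inter> ball p e = {}"
    proof (rule ccontr)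
      assume "A \<inter> ball p e \<noteq> {}"
      then have "f y = 0" if "y \<in> ball p e" for y
        using power_series_on_eq_0[OF e(2) open_Int[OF A(1) open_ball] Int_lower2 _ A(3) that] by blast
      then have "ball p e \<subseteq> A"
        unfolding A_def using e by (intro interior_maximal) auto
      with p e show False by (metis DiffD2 centre_in_ball subsetD)
    qed
    with e show "\<exists>e>0. ball p e \<subseteq> S - A" by blast
  qed
  then have "A \<inter> S = {} \<or> (S - A) \<inter> S = {}"
    using A(1,2) by (intro connectedD[OF S(2)]) blast+
  with \<open>U \<subseteq> A\<close> U x A show ?thesis by blast
qed

section \<open>Symmetry of mixed derivatives\<close>

lemma DERIV_along_line:
  fixes f :: "'a::real_normed_vector \<Rightarrow> real"
  assumes "(f has_derivative f') (at (q + s *\<^sub>R v))"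
  shows "((\<lambda>s. f (q + s *\<^sub>R v)) has_real_derivative f' v) (at s)"
proof -
  have "((\<lambda>s. q + s *\<^sub>R v) has_derivative (\<lambda>s. s *\<^sub>R v)) (at s)"
    by (auto intro!: derivative_eq_intros)
  from diff_chain_at[OF this assms]
  have "((\<lambda>s. f (q + s *\<^sub>R v)) has_derivative (\<lambda>s. s * f' v)) (at s)"
    by (simp add: o_def linear_cmul[OF has_derivative_linear[OF assms]])
  then show ?thesis
    by (simp add: has_field_derivative_def mult_commute_abs)
qed

text \<open>
  Two applications of the mean value theorem, in the direction \<open>v\<close> and then in the direction \<open>w\<close>.  The
  second difference on the left is symmetric in \<open>v\<close> and \<open>w\<close>, which is what makes mixed
  derivatives equal.
\<close>

lemma second_difference_mean_value:
  fixes f :: "'a::real_normed_vector \<Rightarrow> real"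
  assumes D: "\<And>x. x \<in> ball p r \<Longrightarrow> (f has_derivative f' x) (at x)"
    and DD: "\<And>x. x \<in> ball p r \<Longrightarrow> ((\<lambda>x. f' x v) has_derivative f'' x) (at x)"
    and h: "h > 0" "h * (norm v + norm w) < r"
  obtains x where "dist p x \<le> h * (norm v + norm w)"
    "f (p + h *\<^sub>R v + h *\<^sub>R w) - f (p + h *\<^sub>R v) - f (p + h *\<^sub>R w) + f p = h\<^sup>2 * f'' x w"
proof -
  have dist: "dist p (p + s *\<^sub>R v + t *\<^sub>R w) \<le> h * (norm v + norm w)"
    if "0 \<le> s" "s \<le> h" "0 \<le> t" "t \<le> h" for s t
  proof -
    have "dist p (p + s *\<^sub>R v + t *\<^sub>R w) = norm (s *\<^sub>R v + t *\<^sub>R w)"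
      by (subst dist_commute) (simp add: dist_norm add.assoc)
    also have "\<dots> \<le> s * norm v + t * norm w"
      using norm_triangle_ineq[of "s *\<^sub>R v" "t *\<^sub>R w"] that by simp
    also have "\<dots> \<le> h * (norm v + norm w)"
      using that by (simp add: distrib_left add_mono mult_right_mono)
    finally show ?thesis .
  qed
  have ball: "p + s *\<^sub>R v + t *\<^sub>R w \<in> ball p r"
    if "0 \<le> s" "s \<le> h" "0 \<le> t" "t \<le> h" for s t
    unfolding mem_ball using dist[OF that] h(2) by (rule order.strict_trans1)
  have *: "p + h *\<^sub>R w + s *\<^sub>R v = p + s *\<^sub>R v + h *\<^sub>R w" for s
    by simp
  have "((\<lambda>s. f (p + s *\<^sub>R v + h *\<^sub>R w) - f (p + s *\<^sub>R v)) has_real_derivative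
      f' (p + s *\<^sub>R v + h *\<^sub>R w) v - f' (p + s *\<^sub>R v) v) (at s)" if "0 \<le> s" "s \<le> h" for s
  proof (rule DERIV_diff)
    have "p + h *\<^sub>R w + s *\<^sub>R v \<in> ball p r"
      unfolding * using that h by (intro ball) auto
    from DERIV_along_line[OF D[OF this]]
    show "((\<lambda>s. f (p + s *\<^sub>R v + h *\<^sub>R w)) has_real_derivative f' (p + s *\<^sub>R v + h *\<^sub>R w) v) (at s)"
      unfolding * .
    have "p + s *\<^sub>R v \<in> ball p r"
      using ball[of s 0] that h by simp
    then show "((\<lambda>s. f (p + s *\<^sub>R v)) has_real_derivative f' (p + s *\<^sub>R v) v) (at s)"
      by (rule DERIV_along_line[OF D])
  qed
  from MVT2[OF h(1) this] obtain s where s: "0 < s" "s < h"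
    "f (p + h *\<^sub>R v + h *\<^sub>R w) - f (p + h *\<^sub>R v) - (f (p + h *\<^sub>R w) - f p)
      = h * (f' (p + s *\<^sub>R v + h *\<^sub>R w) v - f' (p + s *\<^sub>R v) v)"
    by auto
  have "((\<lambda>t. f' (p + s *\<^sub>R v + t *\<^sub>R w) v) has_real_derivative f'' (p + s *\<^sub>R v + t *\<^sub>R w) w) (at t)"
    if "0 \<le> t" "t \<le> h" for t
    using DERIV_along_line[OF DD[OF ball[of s t]]] that s by simp
  from MVT2[OF h(1) this] obtain t where t: "0 < t" "t < h"
    "f' (p + s *\<^sub>R v + h *\<^sub>R w) v - f' (p + s *\<^sub>R v) v = h * f'' (p + s *\<^sub>R v + t *\<^sub>R w) w"
    by auto
  show ?thesis
    using s t dist[of s t] by (intro that[of "p + s *\<^sub>R v + t *\<^sub>R w"]) (simp_all add: power2_eq_square)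
qed

text \<open>
  Schwarz's theorem.  If the two mixed derivatives differed at \<open>p\<close>, they would by continuity differ at any
  two points near \<open>p\<close>; but a small second difference is a value of each of them, up to the same
  factor.
\<close>

lemma mixed_directional_derivatives_eq_real:
  fixes f :: "'a::real_normed_vector \<Rightarrow> real"
  assumes S: "open S" "p \<in> S"
    and D: "\<And>x. x \<in> S \<Longrightarrow> (f has_derivative f' x) (at x)"
    and Dv: "\<And>x. x \<in> S \<Longrightarrow> ((\<lambda>x. f' x v) has_derivative fv x) (at x)"
    and Dw: "\<And>x. x \<in> S \<Longrightarrow> ((\<lambda>x. f' x w) has_derivative fw x) (at x)"
    and cont: "continuous_on S (\<lambda>x. fv x w)" "continuous_on S (\<lambda>x. fw x v)"
  shows "fv p w = fw p v"
proof (rule ccontr)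
  assume "fv p w \<noteq> fw p v"
  define e where "e = \<bar>fv p w - fw p v\<bar> / 2"
  have e: "e > 0" using \<open>fv p w \<noteq> fw p v\<close> by (simp add: e_def)
  have "isCont (\<lambda>x. fv x w) p" "isCont (\<lambda>x. fw x v) p"
    using cont S by (auto simp: continuous_on_eq_continuous_at)
  then have "\<exists>d>0. \<forall>x. dist x p < d \<longrightarrow> dist (fv x w) (fv p w) < e"
    "\<exists>d>0. \<forall>x. dist x p < d \<longrightarrow> dist (fw x v) (fw p v) < e"
    using e unfolding continuous_at_eps_delta by simp_all
  then obtain d1 d2 where d: "d1 > 0" "\<And>x. dist x p < d1 \<Longrightarrow> dist (fv x w) (fv p w) < e"
    "d2 > 0" "\<And>x. dist x p < d2 \<Longrightarrow> dist (fw x v) (fw p v) < e"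
    by blast
  obtain r0 where r0: "r0 > 0" "ball p r0 \<subseteq> S"
    using S open_contains_ball by blast
  define r where "r = min r0 (min d1 d2)"
  have r: "r > 0" "ball p r \<subseteq> S" "r \<le> d1" "r \<le> d2"
    using r0 d by (auto simp: r_def)
  \<comment> \<open>Adding \<open>1\<close> keeps the denominator positive when both directions are zero.\<close>
  define h where "h = r / (norm v + norm w + 1)"
  have nn: "norm v + norm w + 1 > 0"
    by (simp add: add_nonneg_pos)
  then have h: "h > 0" "h * (norm v + norm w) < r"
    using r by (auto simp: h_def field_simps)
  have h': "h * (norm w + norm v) < r" using h by (simp add: add.commute)
  obtain x where x: "dist p x \<le> h * (norm v + norm w)"
    "f (p + h *\<^sub>R v + h *\<^sub>R w) - f (p + h *\<^sub>R v) - f (p + h *\<^sub>R w) + f p = h\<^sup>2 * fv x w"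
    by (rule second_difference_mean_value[of p r f f' v fv h w]) (use D Dv r h in auto)
  obtain y where y: "dist p y \<le> h * (norm w + norm v)"
    "f (p + h *\<^sub>R w + h *\<^sub>R v) - f (p + h *\<^sub>R w) - f (p + h *\<^sub>R v) + f p = h\<^sup>2 * fw y v"
    by (rule second_difference_mean_value[of p r f f' w fw h v]) (use D Dw r h h' in auto)
  have "h\<^sup>2 * fv x w = h\<^sup>2 * fw y v"
    unfolding x(2)[symmetric] y(2)[symmetric] by (simp add: add_ac)
  then have "fv x w = fw y v" using h by simp
  moreover have "dist x p < d1" "dist y p < d2"
    using x(1) y(1) h h' r by (auto simp: dist_commute)
  ultimately have "\<bar>fv p w - fw p v\<bar> < 2 * e"
    using d(2)[of x] d(4)[of y] by (simp add: dist_real_def)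
  then show False by (simp add: e_def)
qed

lemma mixed_directional_derivatives_eq:
  fixes f :: "'a::real_normed_vector \<Rightarrow> complex"
  assumes S: "open S" "p \<in> S"
    and D: "\<And>x. x \<in> S \<Longrightarrow> (f has_derivative f' x) (at x)"
    and Dv: "\<And>x. x \<in> S \<Longrightarrow> ((\<lambda>x. f' x v) has_derivative fv x) (at x)"
    and Dw: "\<And>x. x \<in> S \<Longrightarrow> ((\<lambda>x. f' x w) has_derivative fw x) (at x)"
    and cont: "continuous_on S (\<lambda>x. fv x w)" "continuous_on S (\<lambda>x. fw x v)"
  shows "fv p w = fw p v"
proof (rule complex_eqI)
  show "Re (fv p w) = Re (fw p v)"
    by (rule mixed_directional_derivatives_eq_real[where f = "\<lambda>x. Re (f x)" and f' = "\<lambda>x v. Re (f' x v)"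
          and fv = "\<lambda>x v. Re (fv x v)" and fw = "\<lambda>x v. Re (fw x v)", OF S])
       (auto intro!: has_derivative_Re D Dv Dw continuous_intros cont)
  show "Im (fv p w) = Im (fw p v)"
    by (rule mixed_directional_derivatives_eq_real[where f = "\<lambda>x. Im (f x)" and f' = "\<lambda>x v. Im (f' x v)"
          and fv = "\<lambda>x v. Im (fv x v)" and fw = "\<lambda>x v. Im (fw x v)", OF S])
       (auto intro!: has_derivative_Im D Dv Dw continuous_intros cont)
qed

section \<open>Closure properties of continuous differentiability\<close>

lemma R_differentiable_imp_differentiable:
  assumes "R_differentiable (Suc r) f S" "open S" "p \<in> S"
  shows "f differentiable (at p)"
proof -
  have "f differentiable_on S" using assms(1) by simp
  then have "f differentiable (at p within S)" using assms(3) by (simp add: differentiable_on_def)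
  then show ?thesis using at_within_open[OF assms(3,2)] by simp
qed

lemma R_differentiable_directional_derivative:
  "R_differentiable (Suc r) f S \<Longrightarrow> R_differentiable r (\<lambda>p. frechet_derivative f (at p) v) S"
  by simp

lemma R_differentiable_SucD: "R_differentiable (Suc r) f S \<Longrightarrow> R_differentiable r f S"
  by (induction r arbitrary: f) (auto intro: differentiable_imp_continuous_on)

lemma R_differentiable_mono: "R_differentiable r f S \<Longrightarrow> s \<le> r \<Longrightarrow> R_differentiable s f S"
  by (rule inc_induct[of s r]) (auto intro: R_differentiable_SucD simp del: R_differentiable.simps)

lemma R_differentiable_subset: "R_differentiable r f S \<Longrightarrow> T \<subseteq> S \<Longrightarrow> R_differentiable r f T"
  by (induction r arbitrary: f) (auto intro: continuous_on_subset differentiable_on_subset)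

lemma R_differentiable_imp_continuous_on: "R_differentiable r f S \<Longrightarrow> continuous_on S f"
  using R_differentiable_mono[of r f S 0] by simp

text \<open>
  Openness is essential for passing from equal values to equal derivatives.  Sums and bounded linear
  images are handled by this lemma, since the formulas for their derivatives hold on \<open>S\<close> only.
\<close>

lemma R_differentiable_cong:
  assumes "open S" "\<And>x. x \<in> S \<Longrightarrow> f x = g x" "R_differentiable r f S"
  shows "R_differentiable r g S"
  using assms(2,3)
proof (induction r arbitrary: f g)
  case 0
  then show ?case by (auto cong: continuous_on_cong)
next
  case (Suc r)
  have "frechet_derivative f (at x) = frechet_derivative g (at x)" if "x \<in> S" for x
    using R_differentiable_imp_differentiable[OF Suc.prems(2) assms(1) that] assms(1) that Suc.prems(1)
    by (rule frechet_derivative_transform_within_open)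
  then have "frechet_derivative f (at x) v = frechet_derivative g (at x) v" if "x \<in> S" for x v
    using that by simp
  moreover have "R_differentiable r (\<lambda>p. frechet_derivative f (at p) v) S" for v
    using Suc.prems(2) by simp
  ultimately have "R_differentiable r (\<lambda>p. frechet_derivative g (at p) v) S" for v
    by (rule Suc.IH)
  moreover have "g differentiable (at x within S)" if "x \<in> S" for x
    by (rule differentiable_transform_within[of f x S 1])
       (use Suc.prems that in \<open>auto simp: differentiable_on_def\<close>)
  ultimately show ?case
    by (auto simp: differentiable_on_def)
qed

lemma R_differentiable_const: "R_differentiable r (\<lambda>_. c) S"
  by (induction r arbitrary: c) (auto simp: frechet_derivative_const)

lemma R_differentiable_add:
  assumes "open S" "R_differentiable r f S" "R_differentiable r g S"
  shows "R_differentiable r (\<lambda>x. f x + g x) S"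
  using assms(2,3)
proof (induction r arbitrary: f g)
  case 0
  then show ?case by (auto intro: continuous_on_add)
next
  case (Suc r)
  have *: "frechet_derivative (\<lambda>x. f x + g x) (at p) v = frechet_derivative f (at p) v + frechet_derivative g (at p) v"
    if "p \<in> S" for p v
    using Suc.prems assms(1) that
    by (subst frechet_derivative_at[symmetric, OF has_derivative_add])
       (auto dest: R_differentiable_imp_differentiable simp: frechet_derivative_works simp del: R_differentiable.simps)
  have "R_differentiable r (\<lambda>p. frechet_derivative (\<lambda>x. f x + g x) (at p) v) S" for v
    by (rule R_differentiable_cong[OF assms(1) _ Suc.IH[of "\<lambda>p. frechet_derivative f (at p) v" "\<lambda>p. frechet_derivative g (at p) v"]])
       (use * Suc.prems in auto)
  with Suc.prems show ?case by auto
qed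

lemma R_differentiable_bounded_linear:
  assumes L: "bounded_linear L" and "open S" "R_differentiable r f S"
  shows "R_differentiable r (\<lambda>x. L (f x)) S"
  using assms(3)
proof (induction r arbitrary: f)
  case 0
  then show ?case using L by (auto intro: bounded_linear.continuous_on)
next
  case (Suc r)
  have D: "((\<lambda>x. L (f x)) has_derivative (\<lambda>v. L (frechet_derivative f (at p) v))) (at p)" if "p \<in> S" for p
    using R_differentiable_imp_differentiable[OF Suc.prems assms(2) that]
    by (intro bounded_linear.has_derivative[OF L]) (simp add: frechet_derivative_works)
  have "R_differentiable r (\<lambda>p. frechet_derivative (\<lambda>x. L (f x)) (at p) v) S" for v
  proof (rule R_differentiable_cong[OF assms(2)])
    show "R_differentiable r (\<lambda>p. L (frechet_derivative f (at p) v)) S"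
      using Suc by auto
    show "L (frechet_derivative f (at p) v) = frechet_derivative (\<lambda>x. L (f x)) (at p) v" if "p \<in> S" for p
      using frechet_derivative_at[OF D[OF that]] by metis
  qed
  moreover have "(\<lambda>x. L (f x)) differentiable_on S"
    unfolding differentiable_on_def
    using D differentiableI differentiable_at_withinI by blast
  ultimately show ?case by auto
qed

lemma R_differentiable_sum:
  assumes "open S" "\<And>i. i \<in> I \<Longrightarrow> R_differentiable r (f i) S"
  shows "R_differentiable r (\<lambda>x. \<Sum>i\<in>I. f i x) S"
  using assms(2) by (induction I rule: infinite_finite_induct)
    (auto intro!: R_differentiable_const R_differentiable_add assms(1))

section \<open>Wirtinger derivatives\<close>

text \<open>
  All four kinds of Wirtinger derivative combine two directional derivatives along vectors of \<open>Basis\<close>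
  with constant coefficients, which lets the proofs below avoid a case distinction.  The vectors
  are coordinate directions, as termwise differentiation of power series requires.
\<close>

lemma wirtinger_directions:
  fixes v :: "('m::finite, 'n::finite) cvar"
  obtains e e' :: "(complex ^ 'm) \<times> (complex ^ 'n)" and \<sigma> :: complex
  where "e \<in> Basis" "e' \<in> Basis"
    "\<And>f p. wirtinger v f p = 1 / 2 * frechet_derivative f (at p) e + \<sigma> * frechet_derivative f (at p) e'"
proof (cases v)
  case (Z j)
  show ?thesis
    by (rule that[of "(axis j 1, 0)" "(axis j \<i>, 0)" "- \<i> / 2"])
       (simp_all add: Z Basis_prod_def axis_in_Basis_iff Basis_complex_def field_simps)
next
  case (Zbar j)
  show ?thesis
    by (rule that[of "(axis j 1, 0)" "(axis j \<i>, 0)" "\<i> / 2"])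
       (simp_all add: Zbar Basis_prod_def axis_in_Basis_iff Basis_complex_def field_simps)
next
  case (W j)
  show ?thesis
    by (rule that[of "(0, axis j 1)" "(0, axis j \<i>)" "- \<i> / 2"])
       (simp_all add: W Basis_prod_def axis_in_Basis_iff Basis_complex_def field_simps)
next
  case (Wbar j)
  show ?thesis
    by (rule that[of "(0, axis j 1)" "(0, axis j \<i>)" "\<i> / 2"])
       (simp_all add: Wbar Basis_prod_def axis_in_Basis_iff Basis_complex_def field_simps)
qed

lemma R_differentiable_wirtinger:
  assumes S: "open S" and f: "R_differentiable (Suc r) f S"
  shows "R_differentiable r (wirtinger v f) S"
proof -
  obtain e e' \<sigma> where w:
    "\<And>f p. wirtinger v f p = 1 / 2 * frechet_derivative f (at p) e + \<sigma> * frechet_derivative f (at p) e'"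
    by (rule wirtinger_directions[of v]) blast
  have "R_differentiable r (\<lambda>p. a * frechet_derivative f (at p) d) S" for a d
    by (intro R_differentiable_bounded_linear[OF bounded_linear_mult_right S]
          R_differentiable_directional_derivative f)
  then have "R_differentiable r (\<lambda>p. 1 / 2 * frechet_derivative f (at p) e + \<sigma> * frechet_derivative f (at p) e') S"
    by (intro R_differentiable_add S)
  moreover have "wirtinger v f = (\<lambda>p. 1 / 2 * frechet_derivative f (at p) e + \<sigma> * frechet_derivative f (at p) e')"
    by (rule ext) (rule w)
  ultimately show ?thesis by simp
qed

lemma R_differentiable_wirtinger_funpow:
  assumes "open S" "R_differentiable (i + r) f S"
  shows "R_differentiable r ((wirtinger v ^^ i) f) S"
  using assms(2)
proof (induction i arbitrary: r)
  case (Suc i)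
  then have "R_differentiable (Suc r) ((wirtinger v ^^ i) f) S"
    by (simp del: R_differentiable.simps)
  then show ?case
    using R_differentiable_wirtinger[OF assms(1)] by simp
qed simp

lemma real_analytic_on_wirtinger:
  assumes S: "open S" and f: "real_analytic_on f S" and diff: "f differentiable_on S"
  shows "real_analytic_on (wirtinger v f) S"
proof -
  obtain e e' \<sigma> where e: "e \<in> Basis" "e' \<in> Basis" and w:
    "\<And>f p. wirtinger v f p = 1 / 2 * frechet_derivative f (at p) e + \<sigma> * frechet_derivative f (at p) e'"
    by (rule wirtinger_directions[of v]) blast
  have "real_analytic_on (\<lambda>p. 1 / 2 * frechet_derivative f (at p) e + \<sigma> * frechet_derivative f (at p) e') S"
    by (intro real_analytic_on_add real_analytic_on_mult real_analytic_on_const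
          real_analytic_on_partial_derivative f S diff e)
  moreover have "wirtinger v f = (\<lambda>p. 1 / 2 * frechet_derivative f (at p) e + \<sigma> * frechet_derivative f (at p) e')"
    by (rule ext) (rule w)
  ultimately show ?thesis by simp
qed

lemma real_analytic_on_wirtinger_funpow:
  assumes "open S" "real_analytic_on f S" "R_differentiable i f S"
  shows "real_analytic_on ((wirtinger v ^^ i) f) S"
  using assms(3)
proof (induction i)
  case (Suc i)
  have "R_differentiable 1 ((wirtinger v ^^ i) f) S"
    using Suc.prems by (intro R_differentiable_wirtinger_funpow assms(1)) (simp del: R_differentiable.simps)
  then have "(wirtinger v ^^ i) f differentiable_on S" by simp
  moreover have "real_analytic_on ((wirtinger v ^^ i) f) S"
    by (rule Suc.IH[OF R_differentiable_SucD[OF Suc.prems]])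
  ultimately show ?case
    using real_analytic_on_wirtinger[OF assms(1)] by simp
qed (simp add: assms(2))

lemmas frechet_derivative_worksI = frechet_derivative_works[THEN iffD1]

lemma frechet_derivative_sum_mult:
  fixes c u :: "'k \<Rightarrow> 'a::real_normed_vector \<Rightarrow> complex"
  assumes "\<And>k. k \<in> I \<Longrightarrow> c k differentiable (at p)" "\<And>k. k \<in> I \<Longrightarrow> u k differentiable (at p)"
  shows "frechet_derivative (\<lambda>x. \<Sum>k\<in>I. c k x * u k x) (at p) e =
    (\<Sum>k\<in>I. c k p * frechet_derivative (u k) (at p) e + frechet_derivative (c k) (at p) e * u k p)"
proof -
  have "((\<lambda>x. \<Sum>k\<in>I. c k x * u k x) has_derivative
    (\<lambda>e. \<Sum>k\<in>I. c k p * frechet_derivative (u k) (at p) e + frechet_derivative (c k) (at p) e * u k p)) (at p)"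
    using assms by (intro has_derivative_sum has_derivative_mult frechet_derivative_worksI)
  then show ?thesis
    by (rule fun_cong[OF frechet_derivative_at[symmetric]])
qed

lemma wirtinger_sum_mult:
  assumes "\<And>k. k \<in> I \<Longrightarrow> c k differentiable (at p)" "\<And>k. k \<in> I \<Longrightarrow> u k differentiable (at p)"
  shows "wirtinger v (\<lambda>x. \<Sum>k\<in>I. c k x * u k x) p =
    (\<Sum>k\<in>I. c k p * wirtinger v (u k) p + wirtinger v (c k) p * u k p)"
proof -
  obtain e e' \<sigma> where w:
    "\<And>f p. wirtinger v f p = 1 / 2 * frechet_derivative f (at p) e + \<sigma> * frechet_derivative f (at p) e'"
    by (rule wirtinger_directions[of v]) blast
  have "frechet_derivative (\<lambda>x. \<Sum>k\<in>I. c k x * u k x) (at p) d =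
    (\<Sum>k\<in>I. c k p * frechet_derivative (u k) (at p) d + frechet_derivative (c k) (at p) d * u k p)" for d
    by (rule frechet_derivative_sum_mult) (use assms in auto)
  then show ?thesis
    by (simp add: w sum_distrib_left sum.distrib[symmetric] algebra_simps)
qed

lemma wirtinger_eq_0_of_vanishing:
  assumes "open S" "p \<in> S" "\<And>x. x \<in> S \<Longrightarrow> f x = 0"
  shows "wirtinger v f p = 0"
proof -
  have "frechet_derivative (\<lambda>_. 0) (at p) = frechet_derivative f (at p)"
    by (rule frechet_derivative_transform_within_open[OF _ assms(1,2)]) (simp_all add: assms(3))
  then have "frechet_derivative f (at p) = (\<lambda>_. 0)"
    by (simp add: frechet_derivative_const)
  then show ?thesis
    by (cases v) simp_all
qed

lemma directional_derivatives_commute: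
  fixes f :: "'a::real_normed_vector \<Rightarrow> complex"
  assumes S: "open S" "p \<in> S" and f: "R_differentiable 2 f S"
  shows "frechet_derivative (\<lambda>x. frechet_derivative f (at x) d) (at p) e
       = frechet_derivative (\<lambda>x. frechet_derivative f (at x) e) (at p) d"
proof (rule mixed_directional_derivatives_eq[OF S])
  have f': "R_differentiable (Suc (Suc 0)) f S"
    using f by (simp only: numeral_2_eq_2)
  then have f'': "R_differentiable (Suc 0) (\<lambda>x. frechet_derivative f (at x) d) S" for d
    by (rule R_differentiable_directional_derivative)
  show "(f has_derivative frechet_derivative f (at x)) (at x)" if "x \<in> S" for x
    using R_differentiable_imp_differentiable[OF f' S(1) that] by (simp add: frechet_derivative_works)
  show "((\<lambda>x. frechet_derivative f (at x) d) has_derivative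
      frechet_derivative (\<lambda>x. frechet_derivative f (at x) d) (at x)) (at x)"
    "((\<lambda>x. frechet_derivative f (at x) e) has_derivative
      frechet_derivative (\<lambda>x. frechet_derivative f (at x) e) (at x)) (at x)" if "x \<in> S" for x
    using R_differentiable_imp_differentiable[OF f'' S(1) that] by (simp_all add: frechet_derivative_works)
  show "continuous_on S (\<lambda>x. frechet_derivative (\<lambda>x. frechet_derivative f (at x) d) (at x) e)"
    "continuous_on S (\<lambda>x. frechet_derivative (\<lambda>x. frechet_derivative f (at x) e) (at x) d)"
    using R_differentiable_directional_derivative[OF f''] by (simp_all only: R_differentiable.simps(1))
qed

lemma wirtinger_commute:
  assumes S: "open S" "p \<in> S" and f: "R_differentiable 2 f S"
  shows "wirtinger v (wirtinger u f) p = wirtinger u (wirtinger v f) p"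
proof -
  obtain e e' \<sigma> where v:
    "\<And>f p. wirtinger v f p = 1 / 2 * frechet_derivative f (at p) e + \<sigma> * frechet_derivative f (at p) e'"
    by (rule wirtinger_directions[of v]) blast
  obtain d d' \<tau> where u:
    "\<And>f p. wirtinger u f p = 1 / 2 * frechet_derivative f (at p) d + \<tau> * frechet_derivative f (at p) d'"
    by (rule wirtinger_directions[of u]) blast
  have "R_differentiable (Suc 0) (\<lambda>x. frechet_derivative f (at x) a) S" for a
    by (rule R_differentiable_directional_derivative) (use f in \<open>simp only: numeral_2_eq_2\<close>)
  then have diff: "(\<lambda>x. frechet_derivative f (at x) a) differentiable (at p)" for a
    using R_differentiable_imp_differentiable S by blast
  have lin: "frechet_derivative (\<lambda>x. s * frechet_derivative f (at x) a + t * frechet_derivative f (at x) b) (at p) c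
      = s * frechet_derivative (\<lambda>x. frechet_derivative f (at x) a) (at p) c
      + t * frechet_derivative (\<lambda>x. frechet_derivative f (at x) b) (at p) c" for a b c s t
  proof -
    have "((\<lambda>x. s * frechet_derivative f (at x) a + t * frechet_derivative f (at x) b) has_derivative
       (\<lambda>c. s * frechet_derivative (\<lambda>x. frechet_derivative f (at x) a) (at p) c
      + t * frechet_derivative (\<lambda>x. frechet_derivative f (at x) b) (at p) c)) (at p)"
      using diff by (intro has_derivative_add has_derivative_mult_right) (simp_all add: frechet_derivative_works)
    then show ?thesis
      by (rule fun_cong[OF frechet_derivative_at[symmetric]])
  qed
  show ?thesis
    unfolding v[abs_def] u[abs_def] lin
    by (simp add: directional_derivatives_commute[OF S f, of d] directional_derivatives_commute[OF S f, of d']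
          algebra_simps)
qed

section \<open>Wronskians\<close>

text \<open>
  Differentiating the relation produces two sums by the product rule, and the one containing the
  derivatives of the coefficients vanishes.
\<close>

lemma iterated_wirtinger_relation:
  assumes S: "open S"
    and u: "\<And>k. k < n \<Longrightarrow> R_differentiable N (u k) S"
    and c: "\<And>k. k < n \<Longrightarrow> R_differentiable 1 (c k) S"
    and c0: "\<And>k p. k < n \<Longrightarrow> p \<in> S \<Longrightarrow> wirtinger v (c k) p = 0"
    and rel: "\<And>p. p \<in> S \<Longrightarrow> (\<Sum>k<n. c k p * u k p) = 0"
    and "i \<le> N" "p \<in> S"
  shows "(\<Sum>k<n. c k p * (wirtinger v ^^ i) (u k) p) = 0"
  using \<open>i \<le> N\<close> \<open>p \<in> S\<close>
proof (induction i arbitrary: p)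
  case 0
  then show ?case using rel by simp
next
  case (Suc i)
  have "R_differentiable (Suc 0) ((wirtinger v ^^ i) (u k)) S" if "k < n" for k
    using Suc.prems u[OF that]
    by (intro R_differentiable_wirtinger_funpow S) (auto intro: R_differentiable_mono simp del: R_differentiable.simps)
  then have ui: "(wirtinger v ^^ i) (u k) differentiable (at p)" if "k < n" for k
    using R_differentiable_imp_differentiable S Suc.prems(2) that by blast
  have ci: "c k differentiable (at p)" if "k < n" for k
    using c[OF that, unfolded One_nat_def] S Suc.prems(2) by (rule R_differentiable_imp_differentiable)
  have "wirtinger v (\<lambda>x. \<Sum>k<n. c k x * (wirtinger v ^^ i) (u k) x) p = 0"
    using Suc by (intro wirtinger_eq_0_of_vanishing[OF S]) auto
  moreover have "wirtinger v (\<lambda>x. \<Sum>k<n. c k x * (wirtinger v ^^ i) (u k) x) p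
      = (\<Sum>k<n. c k p * wirtinger v ((wirtinger v ^^ i) (u k)) p + wirtinger v (c k) p * (wirtinger v ^^ i) (u k) p)"
    using ui ci by (intro wirtinger_sum_mult) auto
  ultimately show ?case
    using c0 Suc.prems(2) by simp
qed

lemma wronskian_eq_0_of_relation:
  assumes rel: "\<And>i. i < length us \<Longrightarrow> (\<Sum>k<length us. z k * (wirtinger v ^^ i) (us ! k) p) = 0"
    and z: "k < length us" "z k \<noteq> 0"
  shows "wronskian v us p = 0"
proof -
  define n where "n = length us"
  define A where "A = Matrix.mat n n (\<lambda>(i, k). (wirtinger v ^^ i) (us ! k) p)"
  define x where "x = Matrix.vec n z"
  have "x \<noteq> 0\<^sub>v n"
  proof
    assume "x = 0\<^sub>v n"
    then have "vec_index x k = vec_index (0\<^sub>v n) k" by simp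
    with z show False by (simp add: x_def n_def)
  qed
  moreover have "A *\<^sub>v x = 0\<^sub>v n"
    using rel by (intro eq_vecI)
      (auto simp: A_def x_def n_def scalar_prod_def lessThan_atLeast0 mult.commute intro!: sum.cong)
  moreover have "A \<in> carrier_mat n n" "x \<in> carrier_vec n"
    by (simp_all add: A_def x_def)
  ultimately have "Determinant.det A = 0"
    using det_0_iff_vec_prod_zero_field by blast
  then show ?thesis
    by (simp add: wronskian_def A_def n_def)
qed

lemma wronskian_expand:
  "wronskian v us p = (\<Sum>\<pi> | \<pi> permutes {0..<length us}.
     signof \<pi> * (\<Prod>i = 0..<length us. (wirtinger v ^^ i) (us ! \<pi> i) p))"
  unfolding wronskian_def Determinant.det_def
  by (auto intro!: sum.cong prod.cong simp: permutes_in_image atLeast0LessThan)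

lemma R_differentiable_wronskian_entry:
  assumes "open S" "\<And>u. u \<in> set us \<Longrightarrow> R_differentiable (length us - 1) u S"
    "\<pi> permutes {0..<length us}" "i < length us"
  shows "R_differentiable i (us ! \<pi> i) S"
proof -
  have "\<pi> i < length us" using assms(3,4) permutes_in_image[of \<pi> _ i] by fastforce
  then have "R_differentiable (length us - 1) (us ! \<pi> i) S"
    by (intro assms(2)) simp
  then show ?thesis
    by (rule R_differentiable_mono) (use assms(4) in simp)
qed

lemma continuous_on_wronskian:
  assumes "open S" "\<And>u. u \<in> set us \<Longrightarrow> R_differentiable (length us - 1) u S"
  shows "continuous_on S (wronskian v us)"
proof -
  have "continuous_on S ((wirtinger v ^^ i) (us ! \<pi> i))"
    if "\<pi> permutes {0..<length us}" "i < length us" for \<pi> i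
    using R_differentiable_wirtinger_funpow[of S i 0 "us ! \<pi> i" v]
      R_differentiable_wronskian_entry[OF assms that] assms(1) by simp
  then show ?thesis
    unfolding wronskian_expand[abs_def] by (intro continuous_intros) auto
qed

lemma real_analytic_on_wronskian:
  assumes "open S" "\<And>u. u \<in> set us \<Longrightarrow> R_differentiable (length us - 1) u S"
    and "\<And>u. u \<in> set us \<Longrightarrow> real_analytic_on u S"
  shows "real_analytic_on (wronskian v us) S"
proof -
  have "real_analytic_on ((wirtinger v ^^ i) (us ! \<pi> i)) S"
    if "\<pi> permutes {0..<length us}" "i < length us" for \<pi> i
  proof (rule real_analytic_on_wirtinger_funpow[OF assms(1)])
    have "\<pi> i < length us" using that permutes_in_image[of \<pi> _ i] by fastforce
    then show "real_analytic_on (us ! \<pi> i) S" by (intro assms(3)) simp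
    show "R_differentiable i (us ! \<pi> i) S"
      by (rule R_differentiable_wronskian_entry[OF assms(1,2) that])
  qed
  then show ?thesis
    unfolding wronskian_expand[abs_def]
    by (intro real_analytic_on_sum real_analytic_on_mult real_analytic_on_const real_analytic_on_prod) auto
qed

text \<open>
  The list \<open>cs\<close> holds the coefficients of a linear relation between the functions of the Wronskian.  Its
  member \<open>\<mu>\<close> makes the vector of coefficients nonzero on a nonempty open set, where the Wronskian is
  zero by linear algebra; continuity or the identity theorem then leads to \<open>p\<close>.
\<close>

lemma wronskian_vanishes:
  fixes p :: "(complex ^ 'm::finite) \<times> (complex ^ 'n::finite)"
  assumes G: "open G" "connected G" and G': "open G'" "G' \<subseteq> G"
    and us: "\<And>u. u \<in> set us \<Longrightarrow> R_differentiable (length us - 1) u G"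
    and len: "length cs = length us"
    and cs: "\<And>c. c \<in> set cs \<Longrightarrow> R_differentiable 1 c G'"
      "\<And>c q. c \<in> set cs \<Longrightarrow> q \<in> G' \<Longrightarrow> wirtinger v c q = 0"
    and rel: "\<And>q. q \<in> G' \<Longrightarrow> sum_list (map2 (\<lambda>c u. c q * u q) cs us) = 0"
    and \<mu>: "\<mu> \<in> set cs" "\<exists>q\<in>G'. \<mu> q \<noteq> 0"
    and p: "p \<in> G"
    and alt: "(\<forall>u\<in>set us. real_analytic_on u G) \<or> p \<in> closure {q \<in> G'. \<mu> q \<noteq> 0}"
  shows "wronskian v us p = 0"
proof -
  define U where "U = {q \<in> G'. \<mu> q \<noteq> 0}"
  have us': "R_differentiable (length us - 1) u G'" if "u \<in> set us" for u
    using us[OF that] G'(2) by (rule R_differentiable_subset)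
  have "wronskian v us q = 0" if "q \<in> U" for q
  proof -
    from \<mu>(1) len obtain k where k: "k < length us" "cs ! k = \<mu>"
      by (metis in_set_conv_nth)
    have "(\<Sum>k<length us. (cs ! k) q * (wirtinger v ^^ i) (us ! k) q) = 0" if "i < length us" for i
    proof (rule iterated_wirtinger_relation[OF G'(1), where N = "length us - 1"])
      show "(\<Sum>k<length us. (cs ! k) x * (us ! k) x) = 0" if "x \<in> G'" for x
        using rel[OF that] len by (simp add: sum_list_sum_nth lessThan_atLeast0)
    qed (use us' cs len that \<open>q \<in> U\<close> in \<open>auto simp: U_def simp del: R_differentiable.simps\<close>)
    then show ?thesis
      using k \<open>q \<in> U\<close> by (intro wronskian_eq_0_of_relation[where z = "\<lambda>k. (cs ! k) q" and k = k]) (auto simp: U_def)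
  qed
  note zero = this
  \<comment> \<open>Openness of \<open>U\<close> is what the identity theorem needs.\<close>
  have "open U"
  proof -
    have "continuous_on G' \<mu>" using cs(1)[OF \<mu>(1)] by (rule R_differentiable_imp_continuous_on)
    then have "open (G' \<inter> \<mu> -` (- {0}))"
      using G'(1) by (rule continuous_open_preimage) auto
    moreover have "U = G' \<inter> \<mu> -` (- {0})" by (auto simp: U_def)
    ultimately show ?thesis by simp
  qed
  from alt show ?thesis
  proof
    assume "\<forall>u\<in>set us. real_analytic_on u G"
    then have "real_analytic_on (wronskian v us) G"
      using us by (intro real_analytic_on_wronskian G) auto
    then show ?thesis
    proof (rule real_analytic_on_identity[OF _ G \<open>open U\<close>])
      show "U \<subseteq> G" "U \<noteq> {}" using G'(2) \<mu>(2) by (auto simp: U_def)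
    qed (use p zero in auto)
  next
    assume "p \<in> closure {q \<in> G'. \<mu> q \<noteq> 0}"
    then have "p \<in> closure U" by (simp add: U_def)
    then obtain x where x: "\<And>n. x n \<in> U" "x \<longlonglongrightarrow> p"
      by (auto simp: closure_sequential)
    have "isCont (wronskian v us) p"
      using continuous_on_wronskian[OF G(1) us] p G(1) by (simp add: continuous_on_eq_continuous_at)
    then have "(\<lambda>n. wronskian v us (x n)) \<longlonglongrightarrow> wronskian v us p"
      using x(2) by (rule isCont_tendsto_compose)
    with zero x(1) have "(\<lambda>_::nat. 0) \<longlonglongrightarrow> wronskian v us p" by simp
    then show ?thesis using LIMSEQ_unique tendsto_const by blast
  qed
qed

section \<open>Last multipliers\<close>

lemma R_differentiable_cnj:
  assumes "open S" "R_differentiable r f S"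
  shows "R_differentiable r (\<lambda>x. cnj (f x)) S"
  using R_differentiable_bounded_linear[OF bounded_linear_cnj assms] .

lemma R_differentiable_divergence:
  assumes S: "open S" and X: "\<And>\<xi> l. R_differentiable (Suc r) (X \<xi> l) S"
  shows "R_differentiable r (divergence X l) S"
  unfolding divergence_def[abs_def]
  by (intro R_differentiable_sum R_differentiable_add R_differentiable_wirtinger R_differentiable_cnj S X)

lemma real_analytic_on_divergence:
  assumes S: "open S" and X: "\<And>\<xi> l. R_differentiable 1 (X \<xi> l) S"
    and an: "\<And>\<xi> l. real_analytic_on (X \<xi> l) S"
  shows "real_analytic_on (divergence X l) S"
proof -
  have "X \<xi> l differentiable_on S" for \<xi> l
    using X by simp
  moreover have "(\<lambda>x. cnj (X \<xi> l x)) differentiable_on S" for \<xi> l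
    using R_differentiable_cnj[OF S X] by simp
  ultimately show ?thesis
    unfolding divergence_def[abs_def]
    by (intro real_analytic_on_sum real_analytic_on_add real_analytic_on_wirtinger real_analytic_on_cnj S an)
qed

text \<open>
  The derivatives of \<open>\<mu>\<close>, arranged in the order of the entries of \<open>lamX\<close> whose coefficients they are in
  the multiplier equation.
\<close>

definition lam_gradient ::
  "('m::finite, 'n::finite) cfun \<Rightarrow> (nat \<Rightarrow> 'n) \<Rightarrow> nat \<Rightarrow> nat \<Rightarrow> (nat \<Rightarrow> nat) \<Rightarrow> ('m, 'n) cfun list" where
  "lam_gradient \<mu> b k1 k2 \<zeta> =
     map (\<lambda>\<xi>. wirtinger (W (b \<xi>)) \<mu>) [1..<Suc k1] @
     map (\<lambda>\<delta>. wirtinger (Wbar (b (\<zeta> \<delta>))) \<mu>) [1..<Suc k2]"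

lemma sum_list_map2_map: "sum_list (map2 h (map f xs) (map g xs)) = sum_list (map (\<lambda>x. h (f x) (g x)) xs)"
  by (induction xs) auto

lemma sum_over_numbering:
  fixes e :: "nat \<Rightarrow> 'n::finite" and h :: "'n \<Rightarrow> complex"
  assumes e: "bij_betw e {1..CARD('n)} UNIV" and k: "k \<le> CARD('n)"
    and zero: "\<And>i. k < i \<Longrightarrow> i \<le> CARD('n) \<Longrightarrow> h (e i) = 0"
  shows "(\<Sum>\<xi>\<in>UNIV. h \<xi>) = sum_list (map (\<lambda>i. h (e i)) [1..<Suc k])"
proof -
  have "(\<Sum>\<xi>\<in>UNIV. h \<xi>) = (\<Sum>i\<in>{1..CARD('n)}. h (e i))"
    using sum.reindex_bij_betw[OF e, of h] by simp
  also have "\<dots> = (\<Sum>i\<in>{1..<Suc k}. h (e i))"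
    using k zero by (intro sum.mono_neutral_right) auto
  also have "\<dots> = sum_list (map (\<lambda>i. h (e i)) [1..<Suc k])"
    by (simp add: sum_list_distinct_conv_sum_set del: upt_Suc)
  finally show ?thesis .
qed

lemma reduced_multiplier_equation:
  fixes X :: "('m::finite, 'n::finite) coeffs"
  assumes b: "bij_betw b {1..CARD('n)} UNIV" and \<zeta>: "\<zeta> permutes {1..CARD('n)}"
    and k: "k1 \<le> CARD('n)" "k2 \<le> CARD('n)"
    and \<mu>: "last_multiplier X S \<mu>" and q: "q \<in> S"
    and W0: "\<And>\<gamma>. k1 < \<gamma> \<Longrightarrow> \<gamma> \<le> CARD('n) \<Longrightarrow> wirtinger (W (b \<gamma>)) \<mu> q = 0"
    and Wbar0: "\<And>\<delta>. k2 < \<delta> \<Longrightarrow> \<delta> \<le> CARD('n) \<Longrightarrow> wirtinger (Wbar (b (\<zeta> \<delta>))) \<mu> q = 0"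
  shows "wirtinger (base_var l) \<mu> q
    + sum_list (map2 (\<lambda>c u. c q * u q) (lam_gradient \<mu> b k1 k2 \<zeta>) (lamX X b k1 k2 \<zeta> l))
    + \<mu> q * divergence X l q = 0"
proof -
  have b\<zeta>: "bij_betw (\<lambda>i. b (\<zeta> i)) {1..CARD('n)} UNIV"
    using bij_betw_trans[OF permutes_imp_bij[OF \<zeta>] b] by (simp add: o_def)
  have "vfield X l \<mu> q = - \<mu> q * divergence X l q"
    using \<mu> q by (auto simp: last_multiplier_def)
  moreover have "(\<Sum>\<xi>\<in>UNIV. wirtinger (W \<xi>) \<mu> q * X \<xi> l q)
      = sum_list (map (\<lambda>i. wirtinger (W (b i)) \<mu> q * X (b i) l q) [1..<Suc k1])"
    by (rule sum_over_numbering[OF b k(1)]) (simp add: W0 del: wirtinger.simps)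
  moreover have "(\<Sum>\<xi>\<in>UNIV. wirtinger (Wbar \<xi>) \<mu> q * cnj (X \<xi> (conj_col l) q))
      = sum_list (map (\<lambda>i. wirtinger (Wbar (b (\<zeta> i))) \<mu> q * cnj (X (b (\<zeta> i)) (conj_col l) q)) [1..<Suc k2])"
    by (rule sum_over_numbering[OF b\<zeta> k(2)]) (simp add: Wbar0 del: wirtinger.simps)
  ultimately show ?thesis
    by (simp add: vfield_def lam_gradient_def lamX_def sum_list_map2_map sum.distrib mult.commute
        del: wirtinger.simps upt_Suc)
qed

text \<open>
  The list \<open>us\<close> is the optional entry \<open>1\<close> of the Wronskian; its coefficient is the derivative of \<open>\<mu>\<close> in
  the base variable of the column, which must vanish when the entry is absent.  The number of entries is
  then at most \<open>k1 + k2 + 2\<close>, so that derivatives up to the order \<open>k1 + k2 + 1\<close> occur in the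
  Wronskian.  As the divergence is itself a first derivative of \<open>X\<close>, this uses up the order
  \<open>k1 + k2 + 2\<close> of differentiability.
\<close>

lemma column_wronskian_vanishes:
  fixes X :: "('m::finite, 'n::finite) coeffs"
  assumes G: "open G" "connected G" "open G'" "G' \<subseteq> G"
    and b: "bij_betw b {1..CARD('n)} UNIV" and \<zeta>: "\<zeta> permutes {1..CARD('n)}"
    and k: "k1 \<le> CARD('n)" "k2 \<le> CARD('n)"
    and X: "\<And>\<xi> l. R_differentiable (k1 + k2 + 2) (X \<xi> l) G"
    and \<mu>: "R_differentiable 2 \<mu> G'" "last_multiplier X G' \<mu>"
    and cyl: "cylindrical (killed_vars a b s1 s2 k1 k2 j \<zeta>) G' \<mu>"
    and v: "v \<in> killed_vars a b s1 s2 k1 k2 j \<zeta>"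
    and p: "p \<in> G"
    and alt: "(\<forall>\<xi> l. real_analytic_on (X \<xi> l) G) \<or> p \<in> closure {q \<in> G'. \<mu> q \<noteq> 0}"
    and us: "us = [\<lambda>_. 1] \<or> us = [] \<and> base_var l \<in> killed_vars a b s1 s2 k1 k2 j \<zeta>"
  shows "wronskian v (us @ lamX X b k1 k2 \<zeta> l @ [divergence X l]) p = 0"
proof (rule wronskian_vanishes[OF G])
  let ?us = "us @ lamX X b k1 k2 \<zeta> l @ [divergence X l]"
  let ?cs = "map (\<lambda>_. wirtinger (base_var l) \<mu>) us @ lam_gradient \<mu> b k1 k2 \<zeta> @ [\<mu>]"
  have len: "length ?us - 1 \<le> k1 + k2 + 1"
    using us by (auto simp: lamX_def)
  have div: "R_differentiable (k1 + k2 + 1) (divergence X l) G"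
    using X by (intro R_differentiable_divergence G) simp
  have set_us: "set ?us \<subseteq> insert (\<lambda>_. 1) (insert (divergence X l)
      ((\<lambda>\<xi>. X \<xi> l) ` UNIV \<union> (\<lambda>\<xi> x. cnj (X \<xi> (conj_col l) x)) ` UNIV))"
    using us by (auto simp: lamX_def)
  have "R_differentiable (k1 + k2 + 1) u G" if "u \<in> set ?us" for u
  proof -
    have "R_differentiable (k1 + k2 + 1) (X \<xi> l) G" for \<xi> l
      using X by (rule R_differentiable_mono) simp
    then show ?thesis
      using that set_us div R_differentiable_cnj[OF G(1)] R_differentiable_const by blast
  qed
  then show "R_differentiable (length ?us - 1) u G" if "u \<in> set ?us" for u
    using that len R_differentiable_mono by blast
  show "length ?cs = length ?us"
    by (simp add: lam_gradient_def lamX_def)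
  have set_cs: "set ?cs \<subseteq> insert \<mu> (range (\<lambda>\<omega>. wirtinger \<omega> \<mu>))"
    by (auto simp: lam_gradient_def simp del: wirtinger.simps)
  have v0: "wirtinger v \<mu> q = 0" if "q \<in> G'" for q
    using cyl v that by (auto simp: cylindrical_def)
  show "R_differentiable 1 c G'" if "c \<in> set ?cs" for c
  proof -
    have "R_differentiable 1 (wirtinger \<omega> \<mu>) G'" for \<omega>
      by (rule R_differentiable_wirtinger[OF G(3)]) (use \<mu>(1) in \<open>simp only: numeral_2_eq_2 One_nat_def\<close>)
    moreover have "R_differentiable 1 \<mu> G'"
      using \<mu>(1) by (rule R_differentiable_mono) simp
    ultimately show ?thesis using that set_cs by blast
  qed
  show "wirtinger v c q = 0" if "c \<in> set ?cs" "q \<in> G'" for c q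
  proof -
    have "wirtinger v (wirtinger \<omega> \<mu>) q = 0" for \<omega>
      unfolding wirtinger_commute[OF G(3) \<open>q \<in> G'\<close> \<mu>(1), of v \<omega>]
      by (rule wirtinger_eq_0_of_vanishing[OF G(3) \<open>q \<in> G'\<close> v0])
    with v0[OF \<open>q \<in> G'\<close>] that set_cs show ?thesis by blast
  qed
  show "sum_list (map2 (\<lambda>c u. c q * u q) ?cs ?us) = 0" if q: "q \<in> G'" for q
  proof -
    have killed: "wirtinger \<omega> \<mu> q = 0" if "\<omega> \<in> killed_vars a b s1 s2 k1 k2 j \<zeta>" for \<omega>
      using cyl that q by (auto simp: cylindrical_def)
    have "wirtinger (base_var l) \<mu> q
      + sum_list (map2 (\<lambda>c u. c q * u q) (lam_gradient \<mu> b k1 k2 \<zeta>) (lamX X b k1 k2 \<zeta> l))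
      + \<mu> q * divergence X l q = 0"
      by (rule reduced_multiplier_equation[OF b \<zeta> k \<mu>(2) q])
         (rule killed, force simp: killed_vars_def)+
    moreover have "length (lam_gradient \<mu> b k1 k2 \<zeta>) = length (lamX X b k1 k2 \<zeta> l)"
      by (simp add: lam_gradient_def lamX_def)
    moreover have "sum_list (map2 (\<lambda>c u. c q * u q) (map (\<lambda>_. wirtinger (base_var l) \<mu>) us) us)
        = wirtinger (base_var l) \<mu> q"
      using us killed[of "base_var l"] by (auto simp del: wirtinger.simps)
    ultimately show ?thesis
      by (simp add: add.assoc del: wirtinger.simps)
  qed
  show "\<mu> \<in> set ?cs" by simp
  show "\<exists>q\<in>G'. \<mu> q \<noteq> 0"
    using \<mu>(2) by (auto simp: last_multiplier_def)
  show "(\<forall>u\<in>set ?us. real_analytic_on u G) \<or> p \<in> closure {q \<in> G'. \<mu> q \<noteq> 0}"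
    using alt
  proof (elim disjE)
    assume an: "\<forall>\<xi> l. real_analytic_on (X \<xi> l) G"
    have "R_differentiable 1 (X \<xi> l) G" for \<xi> l
      using X by (rule R_differentiable_mono) simp
    then have "real_analytic_on (divergence X l) G"
      using an by (intro real_analytic_on_divergence G) auto
    then have "\<forall>u\<in>set ?us. real_analytic_on u G"
      using set_us an real_analytic_on_cnj real_analytic_on_const by blast
    then show ?thesis by blast
  qed simp
qed (rule p)

theorem theorem1p9:
  fixes X :: "'n::finite \<Rightarrow> 'm::finite + 'm \<Rightarrow> (complex ^ 'm) \<times> (complex ^ 'n) \<Rightarrow> complex"
    and \<mu> :: "(complex ^ 'm) \<times> (complex ^ 'n) \<Rightarrow> complex"
    and G G' :: "((complex ^ 'm) \<times> (complex ^ 'n)) set"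
    and p :: "(complex ^ 'm) \<times> (complex ^ 'n)"
    and a :: "nat \<Rightarrow> 'm" and b :: "nat \<Rightarrow> 'n"
    and s1 s2 k1 k2 :: nat
    and j \<zeta> :: "nat \<Rightarrow> nat"
    and v :: "('m, 'n) cvar"
  assumes "open G" "connected G" "open G'" "connected G'" "G' \<noteq> {}" "G' \<subseteq> G"
    and "bij_betw a {1..CARD('m)} UNIV" "bij_betw b {1..CARD('n)} UNIV"
    and "s1 \<le> CARD('m)" "s2 \<le> CARD('m)" "k1 \<le> CARD('n)" "k2 \<le> CARD('n)"
    and "j permutes {1..CARD('m)}" "\<zeta> permutes {1..CARD('n)}"
    and "\<And>\<xi> l. R_differentiable (k1 + k2 + 2) (X \<xi> l) G"
    and "R_differentiable 2 \<mu> G'"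
    and "last_multiplier X G' \<mu>"
    and "cylindrical (killed_vars a b s1 s2 k1 k2 j \<zeta>) G' \<mu>"
    and "v \<in> killed_vars a b s1 s2 k1 k2 j \<zeta>"
    and "p \<in> G"
    and "(\<forall>\<xi> l. real_analytic_on (X \<xi> l) G) \<or> p \<in> closure {q \<in> G'. \<mu> q \<noteq> 0}"
  shows "(\<forall>\<theta>\<in>{1..s1}. wronskian v
            ((\<lambda>_. 1) # lamX X b k1 k2 \<zeta> (Inl (a \<theta>)) @ [divergence X (Inl (a \<theta>))]) p = 0)
       \<and> (\<forall>\<eta>\<in>{s1 + 1..CARD('m)}. wronskian v
            (lamX X b k1 k2 \<zeta> (Inl (a \<eta>)) @ [divergence X (Inl (a \<eta>))]) p = 0)
       \<and> (\<forall>g\<in>{1..s2}. wronskian v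
            ((\<lambda>_. 1) # lamX X b k1 k2 \<zeta> (Inr (a (j g))) @ [divergence X (Inr (a (j g)))]) p = 0)
       \<and> (\<forall>\<nu>\<in>{s2 + 1..CARD('m)}. wronskian v
            (lamX X b k1 k2 \<zeta> (Inr (a (j \<nu>))) @ [divergence X (Inr (a (j \<nu>)))]) p = 0)"
proof -
  note vanishes = column_wronskian_vanishes[OF assms(1-3,6,8,14,11,12,15-21)]
  have with_1: "wronskian v ((\<lambda>_. 1) # lamX X b k1 k2 \<zeta> l @ [divergence X l]) p = 0" for l
    using vanishes[of "[\<lambda>_. 1]" l] by simp
  have without_1: "wronskian v (lamX X b k1 k2 \<zeta> l @ [divergence X l]) p = 0"
    if "base_var l \<in> killed_vars a b s1 s2 k1 k2 j \<zeta>" for l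
    using vanishes[of "[]" l] that by simp
  have "base_var (Inl (a \<eta>)) \<in> killed_vars a b s1 s2 k1 k2 j \<zeta>" if "\<eta> \<in> {s1 + 1..CARD('m)}" for \<eta>
    using that by (auto simp: killed_vars_def)
  moreover have "base_var (Inr (a (j \<nu>))) \<in> killed_vars a b s1 s2 k1 k2 j \<zeta>" if "\<nu> \<in> {s2 + 1..CARD('m)}" for \<nu>
    using that by (auto simp: killed_vars_def)
  ultimately show ?thesis
    using with_1 without_1 by blast
qed

end
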